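(* Let $X$ be an Asplund space and let $Y_1,Y_2$ be finite-dimensional normed spaces. For $i=1,2$ let $P_i:X\to Y_i$ be continuous, and continuously Fréchet differentiable at $\bar{x}$, let $\Lambda_i\subset Y_i$ be closed, and put $F_i(x):=P_i(x)-\Lambda_i$, with $0\in F_i(\bar{x})$. Let $F:X\rightrightarrows Y_1\times Y_2$ be $F(x):=F_1(x)\times F_2(x)$. Let $u\in X$ satisfy $\nabla P_i(\bar{x})(u)\in T(P_i(\bar{x});\Lambda_i)$ for $i=1,2$. Assume that $F_1$ is metrically subregular at $(\bar{x},0)$ in the direction $u$ and that for all $y_1^*\in Y_1^*$, $y_2^*\in Y_2^*$, $$\left.\begin{aligned}&[\nabla P_1(\bar{x})]^*y_1^*+[\nabla P_2(\bar{x})]^*y_2^*=0,\\&y_i^*\in N\bigl(P_i(\bar{x});\Lambda_i;\nabla P_i(\bar{x})u\bigr),\quad i=1,2,\end{aligned}\right\}\quad\Longrightarrow\quad y_2^*=0.$$ Then $F$ is metrically subregular at $\bigl(\bar{x},(0,0)\bigr)$ in the direction $u$.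
   Context: Notation: $\mathbb{B}$ is a closed unit ball, $\operatorname{dist}(x,\Omega)=\inf_{z\in\Omega}\|x-z\|$ with $\operatorname{dist}(x,\emptyset)=+\infty$, $\operatorname{gph}F$ is the graph; $[\nabla P_i(\bar x)]^*:Y_i^*\to X^*$ is the adjoint of the Fréchet derivative. "Continuously Fréchet differentiable at $\bar x$" means Fréchet differentiable on a neighborhood of $\bar x$ with $\nabla P_i$ continuous at $\bar x$. $Y_1\times Y_2$ carries the sum norm. Cones. For a Banach space $Z$, $\Omega\subset Z$ and $\bar z\in\Omega$: - Contingent cone: $T(\bar z;\Omega)=\{w\in Z\mid\exists\,t_k\downarrow0,\ z_k\in\Omega:\ (z_k-\bar z)/t_k\to w\}$. - $\varepsilon$-normals ($\varepsilon\ge0$): $\widehat N_\varepsilon(\bar z;\Omega)=\{z^*\in Z^*\mid\limsup_{z\to\bar z,\ z\in\Omega,\ z\ne\bar z}\langle z^*,z-\bar z\rangle/\|z-\bar z\|\le\varepsilon\}$ (all of $Z^*$ if $\Omega=\{\bar z\}$; $\emptyset$ at points outside $\Omega$). - Directional limiting normal cone in direction $w\in Z$: $z^*\in N(\bar z;\Omega;w)$ iff there are $\varepsilon_k\downarrow0$, $t_k\downarrow0$, $w_k\to w$ and $z_k^*\to z^*$ (weak$^*$) with $\bar z+t_kw_k\in\Omega$ and $z_k^*\in\widehat N_{\varepsilon_k}(\bar z+t_kw_k;\Omega)$ for all $k$. Directional metric subregularity: with $\mathcal V_{\varepsilon,\delta}(\bar x;d)=\bar x+\{z\in\varepsilon\mathbb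 B\mid\big\|\|d\|z-\|z\|d\big\|\le\delta\|z\|\|d\|\}$, a mapping $F:X\rightrightarrows Y$ is metrically subregular at $(\bar x,\bar y)\in\operatorname{gph}F$ in direction $u$ if there are $\varepsilon,\delta,\kappa>0$ with $\operatorname{dist}(x,F^{-1}(\bar y))\le\kappa\operatorname{dist}(\bar y,F(x))$ for all $x\in\mathcal V_{\varepsilon,\delta}(\bar x;u)$. *)

theory Defs
  imports "HOL-Analysis.Analysis"
begin

(* "differentiable" is Frechet differentiability: its derivative is a bounded linear map. *)
definition asplund_space :: "'a::banach itself \<Rightarrow> bool" where
  "asplund_space _ \<longleftrightarrow>
     (\<forall>(U :: 'a set) (f :: 'a \<Rightarrow> real).
        open U \<and> convex U \<and> convex_on U f \<and> continuous_on U f \<longrightarrow>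
        U \<subseteq> closure {x \<in> U. f differentiable (at x)})"

(* No Euclidean structure is assumed, so the norm is arbitrary. *)
definition finite_dim_space :: "'a::real_normed_vector itself \<Rightarrow> bool" where
  "finite_dim_space _ \<longleftrightarrow> (\<exists>B :: 'a set. finite B \<and> span B = UNIV)"

definition null_seq_pos :: "(nat \<Rightarrow> real) \<Rightarrow> bool" where
  "null_seq_pos t \<longleftrightarrow> (\<forall>k. 0 < t k) \<and> t \<longlonglongrightarrow> 0"

definition contingent_cone :: "'z::real_normed_vector \<Rightarrow> 'z set \<Rightarrow> 'z set" where
  "contingent_cone zbar \<Omega> =
     {w. \<exists>t z. null_seq_pos t \<and> (\<forall>k. z k \<in> \<Omega>) \<and>
           (\<lambda>k. (z k - zbar) /\<^sub>R t k) \<longlonglongrightarrow> w}"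

(* At an isolated point of Omega the filter is trivial and Limsup is -infinity, so
   every functional is an epsilon-normal. *)
definition eps_normals ::
    "real \<Rightarrow> 'z::real_normed_vector \<Rightarrow> 'z set \<Rightarrow> ('z \<Rightarrow>\<^sub>L real) set" where
  "eps_normals \<epsilon> zbar \<Omega> =
     (if zbar \<in> \<Omega> then
        {zs. Limsup (at zbar within \<Omega>)
               (\<lambda>z. ereal (blinfun_apply zs (z - zbar) / norm (z - zbar))) \<le> ereal \<epsilon>}
      else {})"

definition weak_star_tendsto ::
    "(nat \<Rightarrow> 'z::real_normed_vector \<Rightarrow>\<^sub>L real) \<Rightarrow> ('z \<Rightarrow>\<^sub>L real) \<Rightarrow> bool" where
  "weak_star_tendsto zs z \<longleftrightarrow>
     (\<forall>v. (\<lambda>k. blinfun_apply (zs k) v) \<longlonglongrightarrow> blinfun_apply z v)"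

definition dir_limiting_normals ::
    "'z::real_normed_vector \<Rightarrow> 'z set \<Rightarrow> 'z \<Rightarrow> ('z \<Rightarrow>\<^sub>L real) set" where
  "dir_limiting_normals zbar \<Omega> w =
     {zs. \<exists>\<epsilon> t ws zsk.
        null_seq_pos \<epsilon> \<and> null_seq_pos t \<and> ws \<longlonglongrightarrow> w \<and> weak_star_tendsto zsk zs \<and>
        (\<forall>k. zbar + t k *\<^sub>R ws k \<in> \<Omega> \<and>
             zsk k \<in> eps_normals (\<epsilon> k) (zbar + t k *\<^sub>R ws k) \<Omega>)}"

(* The distance is taken with respect to an explicitly given norm N, because the
   library norm on a product type is the Euclidean one and not the sum norm.
   It is extended-real valued so that the distance to the empty set is infinite. *)
definition dist_to_set :: "('a::ab_group_add \<Rightarrow> real) \<Rightarrow> 'a \<Rightarrow> 'a set \<Rightarrow> ereal" where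
  "dist_to_set N x \<Omega> = (INF z\<in>\<Omega>. ereal (N (x - z)))"

definition sum_norm :: "'a::real_normed_vector \<times> 'b::real_normed_vector \<Rightarrow> real" where
  "sum_norm p = norm (fst p) + norm (snd p)"

definition dir_nbhd :: "real \<Rightarrow> real \<Rightarrow> 'a::real_normed_vector \<Rightarrow> 'a \<Rightarrow> 'a set" where
  "dir_nbhd \<epsilon> \<delta> xbar d =
     {xbar + z | z. z \<in> cball 0 \<epsilon> \<and>
        norm (norm d *\<^sub>R z - norm z *\<^sub>R d) \<le> \<delta> * norm z * norm d}"

(* N is the norm of the image space. *)
definition metrically_subregular_dir ::
    "('b::ab_group_add \<Rightarrow> real) \<Rightarrow> ('a::real_normed_vector \<Rightarrow> 'b set) \<Rightarrow>
     'a \<Rightarrow> 'b \<Rightarrow> 'a \<Rightarrow> bool" where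
  "metrically_subregular_dir N F xbar ybar u \<longleftrightarrow>
     ybar \<in> F xbar \<and>
     (\<exists>\<epsilon>>0. \<exists>\<delta>>0. \<exists>\<kappa>>0. \<forall>x \<in> dir_nbhd \<epsilon> \<delta> xbar u.
        dist_to_set norm x {x'. ybar \<in> F x'} \<le> ereal \<kappa> * dist_to_set N ybar (F x))"

(* Meaningful where f is differentiable; Blinfun turns the derivative into an element of
   the normed space of bounded linear maps. *)
definition frechet_grad ::
    "('a::real_normed_vector \<Rightarrow> 'b::real_normed_vector) \<Rightarrow> 'a \<Rightarrow> 'a \<Rightarrow>\<^sub>L 'b" where
  "frechet_grad f x = Blinfun (frechet_derivative f (at x))"

definition cont_frechet_differentiable_at ::
    "('a::real_normed_vector \<Rightarrow> 'b::real_normed_vector) \<Rightarrow> 'a \<Rightarrow> bool" where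
  "cont_frechet_differentiable_at f xbar \<longleftrightarrow>
     eventually (\<lambda>x. f differentiable (at x)) (nhds xbar) \<and> isCont (frechet_grad f) xbar"

definition dual_adjoint ::
    "('a::real_normed_vector \<Rightarrow>\<^sub>L 'b::real_normed_vector) \<Rightarrow> ('b \<Rightarrow>\<^sub>L real) \<Rightarrow> ('a \<Rightarrow>\<^sub>L real)" where
  "dual_adjoint A ys = ys o\<^sub>L A"

definition constraint_map :: "('a \<Rightarrow> 'b::ab_group_add) \<Rightarrow> 'b set \<Rightarrow> 'a \<Rightarrow> 'b set" where
  "constraint_map P \<Lambda> x = {P x - z | z. z \<in> \<Lambda>}"

end

theory Submission
  imports Defs
begin

text \<open>
  If the conclusion fails, there are points x0 approaching xbar in direction u whose distance to
  the solution set dominates every prescribed multiple of the residual of the constraints.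
  Equip Y1 and Y2 with inner products and apply Ekeland's principle to the residual
  (x, z1, z2) \<mapsto> q (P1 x - z1, P2 x - z2), with q the product Hilbert norm, on X \<times> \<Lambda>1 \<times> \<Lambda>2. The
  perturbed minimizer is not a solution, so q is smooth at its residual y, and y / q y is a unit
  vector whose two components are approximate normals to \<Lambda>1 and \<Lambda>2 with almost vanishing adjoint
  sum. Because F1 is subregular, a first component dominating y could be removed at a lower cost
  once the inner product on Y1 is scaled up enough; hence the second component stays away from
  zero. Since Y1 and Y2 have finite dimension, the multipliers subconverge, and the limit violates
  the qualification condition.
\<close>

section \<open>Ekeland's variational principle\<close>

text \<open>The qualification condition controls only the second multiplier, so a limit pair
  concentrated in its first component would contradict nothing; the constants are arranged to
  exclude this. Their order avoids a circle: the subregularity modulus \<open>\<kappa>\<close> and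
  the Lipschitz constant \<open>L\<close> refer to the given norms, \<open>C2\<close> to the form on
  Y2, and only then is the lower constant \<open>m1\<close> of the form on Y1 fixed. Inner products
  enter because the given norms may fail to be smooth; away from zero the Hilbert norm has a
  quadratic upper model, so one vector serves both the equation and the normals.\<close>

lemma complete_Times:
  fixes S :: "'a::metric_space set" and T :: "'b::metric_space set"
  assumes "complete S" "complete T"
  shows "complete (S \<times> T)"
  unfolding complete_def
proof (intro allI impI)
  fix f :: "nat \<Rightarrow> 'a \<times> 'b" assume f: "(\<forall>n. f n \<in> S \<times> T) \<and> Cauchy f"
  then have "\<forall>n. fst (f n) \<in> S" "\<forall>n. snd (f n) \<in> T"
    by (auto simp: mem_Times_iff)
  moreover have "Cauchy (\<lambda>n. fst (f n))" "Cauchy (\<lambda>n. snd (f n))"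
    using f by (auto intro: Cauchy_fst Cauchy_snd)
  ultimately obtain a b where "a \<in> S" "(\<lambda>n. fst (f n)) \<longlonglongrightarrow> a" "b \<in> T" "(\<lambda>n. snd (f n)) \<longlonglongrightarrow> b"
    using assms unfolding complete_def by metis
  then show "\<exists>l\<in>S \<times> T. f \<longlonglongrightarrow> l"
    using tendsto_Pair[of "\<lambda>n. fst (f n)" a sequentially "\<lambda>n. snd (f n)" b]
    by (intro bexI[of _ "(a, b)"]) simp_all
qed

text \<open>A greedy descent along the order in which y lies below x when
  \<open>f y + \<sigma> * dist x y \<le> f x\<close>: each step comes within a geometric error of
  the infimum of f on the section below the current point, so the sections shrink to a single
  point.\<close>

theorem ekeland_variational_principle:
  fixes f :: "'a::metric_space \<Rightarrow> real"
  assumes S: "complete S" and cont: "continuous_on S f" and low: "\<And>x. x \<in> S \<Longrightarrow> c \<le> f x"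
    and x0: "x0 \<in> S" and \<sigma>: "\<sigma> > 0"
  obtains x where "x \<in> S" "f x + \<sigma> * dist x0 x \<le> f x0"
    "\<And>y. y \<in> S \<Longrightarrow> f x \<le> f y + \<sigma> * dist x y"
proof -
  define T where "T x = {y \<in> S. f y + \<sigma> * dist x y \<le> f x}" for x
  have T_refl: "x \<in> T x" if "x \<in> S" for x
    using that by (simp add: T_def)
  have T_trans: "T y \<subseteq> T x" if "y \<in> T x" for x y
  proof
    fix z assume "z \<in> T y"
    moreover have "\<sigma> * dist x z \<le> \<sigma> * dist x y + \<sigma> * dist y z"
      using \<sigma> dist_triangle[of x z y] by (simp flip: distrib_left)
    ultimately show "z \<in> T x"
      using that by (auto simp: T_def)
  qed
  have step: "\<exists>y. y \<in> T x \<and> (\<forall>w\<in>T x. f y \<le> f w + e)" if "x \<in> S" "e > 0" for x and e :: real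
  proof -
    have ne: "f ` T x \<noteq> {}" and bdd: "bdd_below (f ` T x)"
      using T_refl[OF \<open>x \<in> S\<close>] low by (auto simp: T_def intro!: bdd_belowI2)
    have "Inf (f ` T x) < Inf (f ` T x) + e"
      using \<open>e > 0\<close> by simp
    then obtain y where y: "y \<in> T x" "f y < Inf (f ` T x) + e"
      using cInf_lessD[OF ne] by blast
    moreover have "Inf (f ` T x) \<le> f w" if "w \<in> T x" for w
      using that bdd by (intro cInf_lower) auto
    ultimately show ?thesis
      by (smt (verit))
  qed
  have "\<exists>X. \<forall>n. (X n \<in> S \<and> (n = 0 \<longrightarrow> X n = x0)) \<and>
      (X (Suc n) \<in> T (X n) \<and> (\<forall>w\<in>T (X n). f (X (Suc n)) \<le> f w + (1/2)^n))"
  proof (rule dependent_nat_choice)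
    fix x and n :: nat assume "x \<in> S \<and> (n = 0 \<longrightarrow> x = x0)"
    then obtain y where "y \<in> T x" "\<forall>w\<in>T x. f y \<le> f w + (1/2)^n"
      using step[of x "(1/2)^n"] by auto
    then show "\<exists>y. (y \<in> S \<and> (Suc n = 0 \<longrightarrow> y = x0)) \<and> y \<in> T x \<and> (\<forall>w\<in>T x. f y \<le> f w + (1/2)^n)"
      by (auto simp: T_def)
  qed (use x0 in auto)
  then obtain X where X: "X n \<in> S" "X 0 = x0" "X (Suc n) \<in> T (X n)"
      "w \<in> T (X n) \<Longrightarrow> f (X (Suc n)) \<le> f w + (1/2)^n" for n w
    by blast
  have X_mem: "X (n + k) \<in> T (X n)" for n k
  proof (induction k)
    case (Suc k)
    then show ?case using T_trans[OF Suc] X(3)[of "n + k"] by auto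
  qed (simp add: T_refl X)
  \<comment> \<open>The greedy error made in choosing \<open>X (Suc n)\<close> bounds all further
    decrease of f, because the section below it is contained in the one below \<open>X n\<close>;
    the order turns decrease into distance.\<close>
  have diam: "dist (X (Suc n)) y \<le> (1/2)^n / \<sigma>" if "y \<in> T (X (Suc n))" for n y
  proof -
    have "f (X (Suc n)) \<le> f y + (1/2)^n"
      using that T_trans[OF X(3)] X(4) by blast
    then have "\<sigma> * dist (X (Suc n)) y \<le> (1/2)^n"
      using that by (simp add: T_def)
    then show ?thesis
      using \<sigma> by (simp add: field_simps)
  qed
  have lim0: "(\<lambda>n. (1/2)^n / \<sigma>) \<longlonglongrightarrow> 0"
    by (intro tendsto_divide_zero LIMSEQ_power_zero) auto
  have "Cauchy X"
    unfolding Cauchy_altdef2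
  proof (intro allI impI)
    fix e :: real assume "e > 0"
    then obtain n where n: "(1/2)^n / \<sigma> < e"
      using order_tendstoD(2)[OF lim0] by (auto simp: eventually_sequentially)
    have "dist (X k) (X (Suc n)) < e" if "k \<ge> Suc n" for k
      using diam[of "X k" n] X_mem[of "Suc n" "k - Suc n"] that n by (simp add: dist_commute)
    then show "\<exists>N. \<forall>n\<ge>N. dist (X n) (X N) < e"
      by blast
  qed
  then obtain l where l: "l \<in> S" "X \<longlonglongrightarrow> l"
    using S X(1) unfolding complete_def by blast
  have fl: "(\<lambda>n. f (X n)) \<longlonglongrightarrow> f l"
    using cont l X(1) unfolding continuous_on_sequentially comp_def by blast
  have l_mem: "l \<in> T (X n)" for n
  proof -
    have "f l + \<sigma> * dist (X n) l \<le> f (X n)"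
    proof (rule LIMSEQ_le_const2)
      show "(\<lambda>k. f (X k) + \<sigma> * dist (X n) (X k)) \<longlonglongrightarrow> f l + \<sigma> * dist (X n) l"
        by (intro tendsto_intros fl l)
      show "\<exists>N. \<forall>k\<ge>N. f (X k) + \<sigma> * dist (X n) (X k) \<le> f (X n)"
        using X_mem[of n] by (auto simp: T_def le_iff_add)
    qed
    then show ?thesis
      using l by (simp add: T_def)
  qed
  \<comment> \<open>A violating y lies below l, hence in every section, whose radii tend to zero;
    then y equals l, which violates nothing.\<close>
  have "f l \<le> f y + \<sigma> * dist l y" if "y \<in> S" for y
  proof (rule ccontr)
    assume less: "\<not> f l \<le> f y + \<sigma> * dist l y"
    then have "y \<in> T l"
      using that by (simp add: T_def)
    then have "dist (X (Suc n)) y \<le> (1/2)^n / \<sigma>" for n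
      using diam T_trans[OF l_mem] by blast
    then have "(\<lambda>n. dist (X (Suc n)) y) \<longlonglongrightarrow> 0"
      by (intro tendsto_sandwich[OF _ _ tendsto_const lim0]) auto
    moreover have "(\<lambda>n. dist (X (Suc n)) y) \<longlonglongrightarrow> dist l y"
      by (intro tendsto_intros LIMSEQ_Suc l)
    ultimately show False
      using LIMSEQ_unique less by fastforce
  qed
  with l l_mem[of 0] X(2) show thesis
    by (intro that) (auto simp: T_def)
qed

section \<open>Finite-dimensional normed spaces\<close>

text \<open>For an arbitrary norm, boundedness of the coordinate functionals follows by compactness
  in coordinate space; the convergent subsequences come from the same extraction.\<close>

lemma finite_dim_coordinates:
  assumes "finite_dim_space TYPE('a::real_normed_vector)"
  shows "\<exists>(B :: 'a set) \<phi>. finite B \<and> (\<forall>b. bounded_linear (\<phi> b)) \<and> (\<forall>y. (\<Sum>b\<in>B. \<phi> b y *\<^sub>R b) = y) \<and>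
    (\<forall>f :: nat \<Rightarrow> 'a. bounded (range f) \<longrightarrow> (\<exists>l r. strict_mono (r :: nat \<Rightarrow> nat) \<and> (f \<circ> r) \<longlonglongrightarrow> l))"
proof -
  obtain B0 :: "'a set" where B0: "finite B0" "span B0 = UNIV"
    using assms by (auto simp: finite_dim_space_def)
  obtain B where B: "B \<subseteq> B0" "independent B" "span B = UNIV"
    using maximal_independent_subset[of B0] B0 by (metis span_mono span_span top.extremum_uniqueI)
  have fin: "finite B" using B B0 finite_subset by blast
  define \<phi> where "\<phi> b y = representation B y b" for b y
  have \<phi>_sum: "(\<Sum>b\<in>B. \<phi> b y *\<^sub>R b) = y" for y
    unfolding \<phi>_def using sum_representation_eq[OF B(2) _ fin order_refl] B(3) by simp
  have \<phi>_lin: "linear (\<phi> b)" for b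
    using B by (intro linearI) (auto simp: \<phi>_def representation_add representation_scale)
  have \<phi>_unit: "\<phi> b (\<Sum>c\<in>B. e c *\<^sub>R c) = e b" if "b \<in> B" for b e
  proof -
    have "\<phi> b (\<Sum>c\<in>B. e c *\<^sub>R c) = (\<Sum>c\<in>B. e c * \<phi> b c)"
      by (simp add: linear_sum[OF \<phi>_lin] linear_scale[OF \<phi>_lin])
    also have "\<dots> = (\<Sum>c\<in>B. if c = b then e c else 0)"
      by (rule sum.cong) (use B(2) in \<open>auto simp: \<phi>_def representation_basis\<close>)
    finally show ?thesis using that fin by simp
  qed
  have subseq: "\<exists>l r. strict_mono (r :: nat \<Rightarrow> nat) \<and> (f \<circ> r) \<longlonglongrightarrow> l \<and>
      (\<forall>b\<in>B. (\<lambda>n. \<phi> b (f (r n))) \<longlonglongrightarrow> \<phi> b l)"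
    if "\<And>b. b \<in> B \<Longrightarrow> bounded (range (\<lambda>n. \<phi> b (f n)))" for f :: "nat \<Rightarrow> 'a"
  proof -
    have bdd: "bounded ((\<lambda>y. \<phi> b y) ` range f)" if "b \<in> B" for b
      using \<open>\<And>b. b \<in> B \<Longrightarrow> bounded (range (\<lambda>n. \<phi> b (f n)))\<close>[OF that] by (simp add: image_image)
    have "\<exists>l r. strict_mono (r :: nat \<Rightarrow> nat) \<and>
        (\<forall>e>0. eventually (\<lambda>n. \<forall>b\<in>B. dist (\<phi> b (f (r n))) (\<phi> b l) < e) sequentially)"
      using compact_lemma_general[of B "\<lambda>y b. \<phi> b y" f "\<lambda>e. \<Sum>c\<in>B. e c *\<^sub>R c",
          OF fin bdd \<phi>_unit \<phi>_sum] by blast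
    then obtain l r where lr: "strict_mono (r :: nat \<Rightarrow> nat)"
      "\<And>e. e > 0 \<Longrightarrow> eventually (\<lambda>n. \<forall>b\<in>B. dist (\<phi> b (f (r n))) (\<phi> b l) < e) sequentially"
      by blast
    have conv: "(\<lambda>n. \<phi> b (f (r n))) \<longlonglongrightarrow> \<phi> b l" if "b \<in> B" for b
    proof (rule tendstoI)
      fix e :: real assume "e > 0"
      show "\<forall>\<^sub>F n in sequentially. dist (\<phi> b (f (r n))) (\<phi> b l) < e"
        using lr(2)[OF \<open>e > 0\<close>] by eventually_elim (use that in blast)
    qed
    then have "(\<lambda>n. \<Sum>b\<in>B. \<phi> b (f (r n)) *\<^sub>R b) \<longlonglongrightarrow> (\<Sum>b\<in>B. \<phi> b l *\<^sub>R b)"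
      by (intro tendsto_intros) auto
    then show ?thesis
      using lr(1) conv by (auto simp: \<phi>_sum comp_def)
  qed
  define s where "s y = (\<Sum>b\<in>B. \<bar>\<phi> b y\<bar>)" for y
  have s_scale: "s (a *\<^sub>R y) = \<bar>a\<bar> * s y" for a y
    by (simp add: s_def linear_scale[OF \<phi>_lin] abs_mult sum_distrib_left)
  have s_ge: "\<bar>\<phi> b y\<bar> \<le> s y" if "b \<in> B" for b y
    unfolding s_def using that fin by (intro member_le_sum) auto
  \<comment> \<open>Failing this, vectors normalized by \<open>s\<close> have norms tending to zero.
    A subsequence converges in coordinates, hence in norm, and its limit would be zero although
    \<open>s\<close> equals 1 there.\<close>
  have "\<exists>C. \<forall>y. s y \<le> C * norm y"
  proof (rule ccontr)
    assume "\<not> ?thesis"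
    then have "\<exists>y. s y > real n * norm y" for n
      by (meson not_le)
    then obtain y where y: "\<And>n. s (y n) > real n * norm (y n)"
      by metis
    have s_pos: "s (y n) > 0" for n
      using y[of n] by (smt (verit) mult_nonneg_nonneg norm_ge_zero of_nat_0_le_iff)
    define z where "z n = y n /\<^sub>R s (y n)" for n
    have sz: "s (z n) = 1" for n
      using s_pos[of n] by (simp add: z_def s_scale)
    have "bounded (range (\<lambda>n. \<phi> b (z n)))" if "b \<in> B" for b
      using s_ge[OF that] sz by (auto simp: bounded_iff intro!: exI[of _ 1]) metis
    from subseq[OF this] obtain l r where r: "strict_mono (r :: nat \<Rightarrow> nat)" and
      l: "(z \<circ> r) \<longlonglongrightarrow> l" "\<And>b. b \<in> B \<Longrightarrow> (\<lambda>n. \<phi> b (z (r n))) \<longlonglongrightarrow> \<phi> b l"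
      by blast
    have "(\<lambda>n. s (z (r n))) \<longlonglongrightarrow> s l"
      unfolding s_def by (intro tendsto_intros l)
    then have "s l = 1"
      by (simp add: sz LIMSEQ_const_iff)
    have "norm (z n) \<le> inverse (real n)" if "n > 0" for n
      using y[of n] s_pos[of n] that by (simp add: z_def field_simps)
    then have "\<forall>\<^sub>F n in sequentially. norm (z n) \<le> inverse (real n)"
      by (intro eventually_sequentiallyI[of 1]) auto
    then have "z \<longlonglongrightarrow> 0"
      by (rule Lim_null_comparison) (rule lim_inverse_n)
    then have "l = 0"
      using l(1) r LIMSEQ_subseq_LIMSEQ LIMSEQ_unique by blast
    with \<open>s l = 1\<close> show False
      by (simp add: s_def linear_0[OF \<phi>_lin])
  qed
  then obtain C where C: "\<And>y. s y \<le> C * norm y"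
    by blast
  have \<phi>_bl: "bounded_linear (\<phi> b)" if "b \<in> B" for b
    using s_ge[OF that] C by (intro bounded_linear_intro[where K = C])
      (auto simp: linear_add[OF \<phi>_lin] linear_scale[OF \<phi>_lin] mult.commute intro: order_trans)
  have \<phi>_bl': "bounded_linear (\<phi> b)" for b
  proof (cases "b \<in> B")
    case False
    then have "\<phi> b = (\<lambda>y. 0)"
      unfolding \<phi>_def using representation_ne_zero by blast
    then show ?thesis by simp
  qed (rule \<phi>_bl)
  have "\<exists>l r. strict_mono (r :: nat \<Rightarrow> nat) \<and> (f \<circ> r) \<longlonglongrightarrow> l" if f: "bounded (range f)" for f :: "nat \<Rightarrow> 'a"
  proof -
    have "bounded (range (\<lambda>n. \<phi> b (f n)))" for b
      using bounded_linear_image[OF f \<phi>_bl'[of b]] by (simp add: image_image)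
    from subseq[OF this] show ?thesis
      by blast
  qed
  then show ?thesis
    by (intro exI[of _ B] exI[of _ \<phi>] conjI allI impI fin \<phi>_bl' \<phi>_sum)
qed

lemma finite_dim_convergent_subseq:
  fixes f :: "nat \<Rightarrow> 'a::real_normed_vector"
  assumes "finite_dim_space TYPE('a)" "bounded (range f)"
  obtains l r where "strict_mono (r :: nat \<Rightarrow> nat)" "(f \<circ> r) \<longlonglongrightarrow> l"
  using finite_dim_coordinates[OF assms(1)] assms(2) by (elim exE conjE) (metis that)

lemma finite_dim_complete:
  fixes S :: "'a::real_normed_vector set"
  assumes "finite_dim_space TYPE('a)" "closed S"
  shows "complete S"
  unfolding complete_def
proof (intro allI impI)
  fix f :: "nat \<Rightarrow> 'a" assume f: "(\<forall>n. f n \<in> S) \<and> Cauchy f"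
  then have "bounded (range f)"
    using cauchy_imp_bounded by blast
  then obtain l r where "strict_mono (r :: nat \<Rightarrow> nat)" "(f \<circ> r) \<longlonglongrightarrow> l"
    by (rule finite_dim_convergent_subseq[OF assms(1)])
  then have "f \<longlonglongrightarrow> l"
    using Cauchy_converges_subseq f by blast
  then show "\<exists>l\<in>S. f \<longlonglongrightarrow> l"
    using f assms(2) closed_sequentially by blast
qed

section \<open>Equivalent inner products\<close>

text \<open>An inner product whose norm is equivalent to the given one. The lower constant m is a
  parameter because the form on Y1 must be made as steep as other constants demand; the upper
  constant comes with bounded bilinearity.\<close>

locale inner_form = bounded_bilinear ip
  for ip :: "'a::real_normed_vector \<Rightarrow> 'a \<Rightarrow> real" +
  fixes m :: real
  assumes sym: "ip x y = ip y x"
    and m_pos: "m > 0"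
    and lower: "m * norm x \<le> sqrt (ip x x)"
begin

lemma self_nonneg: "ip x x \<ge> 0"
  using lower[of x] m_pos by (smt (verit) mult_nonneg_nonneg norm_ge_zero real_sqrt_lt_0_iff)

lemma self_pos: "x \<noteq> 0 \<Longrightarrow> ip x x > 0"
  using lower[of x] m_pos by (smt (verit) mult_pos_pos zero_less_norm_iff real_sqrt_gt_0_iff)

lemma upper: obtains C where "C > 0" "\<And>x. sqrt (ip x x) \<le> C * norm x"
proof -
  obtain K where K: "K > 0" "\<And>a b. norm (ip a b) \<le> norm a * norm b * K"
    using pos_bounded by blast
  have "sqrt (ip x x) \<le> sqrt K * norm x" for x
  proof -
    have "sqrt (ip x x) \<le> sqrt (K * (norm x)\<^sup>2)"
      using K(2)[of x x] by (simp add: power2_eq_square mult_ac)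
    then show ?thesis by (simp add: real_sqrt_mult)
  qed
  with K(1) show thesis by (intro that[of "sqrt K"]) auto
qed

lemma sqrt_form_add_le:
  assumes "y \<noteq> 0"
  shows "sqrt (ip (y + h) (y + h))
    \<le> sqrt (ip y y) + (ip y h + ip h h / 2) / sqrt (ip y y)"
proof -
  define q where "q = sqrt (ip y y)"
  have q: "q > 0" "q\<^sup>2 = ip y y"
    using self_pos[OF assms] by (auto simp: q_def)
  \<comment> \<open>concavity of the square root\<close>
  have eq: "ip (y + h) (y + h) = q\<^sup>2 + 2 * (ip y h + ip h h / 2)"
    by (simp add: q add_left add_right sym[of h y])
  also have "q\<^sup>2 + 2 * (ip y h + ip h h / 2) \<le> (q + (ip y h + ip h h / 2) / q)\<^sup>2"
    using q by (simp add: power2_sum)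
  finally have le: "ip (y + h) (y + h) \<le> (q + (ip y h + ip h h / 2) / q)\<^sup>2" .
  \<comment> \<open>Comparing squares alone does not suffice, as \<open>ip y h\<close> may be
    negative; this quotient form shows that the right-hand side is nonnegative.\<close>
  have "q + (ip y h + ip h h / 2) / q = (q\<^sup>2 + ip (y + h) (y + h)) / (2 * q)"
    using q(1) unfolding eq by (simp add: field_simps power2_eq_square)
  moreover have "(q\<^sup>2 + ip (y + h) (y + h)) / (2 * q) \<ge> 0"
    using q self_nonneg by (intro divide_nonneg_pos add_nonneg_nonneg) auto
  ultimately show ?thesis
    using real_le_lsqrt[OF _ le] by (simp add: q_def)
qed

lemma Cauchy_Schwarz: "ip x y \<le> sqrt (ip x x) * sqrt (ip y y)"
proof (cases "x = 0")
  case False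
  define a where "a = ip x y / ip x x"
  have "0 \<le> ip (y - a *\<^sub>R x) (y - a *\<^sub>R x)"
    by (rule self_nonneg)
  also have "\<dots> = ip y y - (ip x y)\<^sup>2 / ip x x"
    using self_pos[OF False]
    by (simp add: a_def diff_left diff_right scaleR_left scaleR_right sym[of y x] power2_eq_square)
  finally have "(ip x y)\<^sup>2 \<le> ip x x * ip y y"
    using self_pos[OF False] by (simp add: field_simps)
  then show ?thesis
    by (simp add: real_le_rsqrt flip: real_sqrt_mult)
qed (simp add: zero_left)

lemma sqrt_form_triangle: "sqrt (ip (x + y) (x + y)) \<le> sqrt (ip x x) + sqrt (ip y y)"
proof (rule real_le_lsqrt)
  show "ip (x + y) (x + y) \<le> (sqrt (ip x x) + sqrt (ip y y))\<^sup>2"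
    using Cauchy_Schwarz[of x y]
    by (simp add: add_left add_right sym[of y x] power2_sum self_nonneg)
qed (simp_all add: self_nonneg)

end

text \<open>A coordinate inner product dominates a multiple of the norm, because
  \<open>norm x\<close> is at most the Euclidean coordinate length times the sum of the basis norms;
  rescaling then reaches any prescribed m.\<close>

lemma finite_dim_inner_form:
  assumes "finite_dim_space TYPE('a::real_normed_vector)" "m > 0"
  obtains ip :: "'a::real_normed_vector \<Rightarrow> 'a \<Rightarrow> real" where "inner_form ip m"
proof -
  obtain B :: "'a set" and \<phi> where "finite B \<and> (\<forall>b. bounded_linear (\<phi> b)) \<and> (\<forall>y. (\<Sum>b\<in>B. \<phi> b y *\<^sub>R b) = y) \<and>
    (\<forall>f :: nat \<Rightarrow> 'a. bounded (range f) \<longrightarrow> (\<exists>l r. strict_mono (r :: nat \<Rightarrow> nat) \<and> (f \<circ> r) \<longlonglongrightarrow> l))"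
    using finite_dim_coordinates[OF assms(1)] by (elim exE) (rule that)
  then have B: "finite B" "\<And>b. bounded_linear (\<phi> b)" "\<And>y. (\<Sum>b\<in>B. \<phi> b y *\<^sub>R b) = y"
    by simp_all
  \<comment> \<open>The summand 1 keeps K positive even for an empty basis, that is, for the zero
    space.\<close>
  define K where "K = m * (1 + (\<Sum>b\<in>B. norm b))"
  have K: "K > 0"
    unfolding K_def using assms(2) by (intro mult_pos_pos add_pos_nonneg sum_nonneg) auto
  define ip where "ip x y = K\<^sup>2 * (\<Sum>b\<in>B. \<phi> b x * \<phi> b y)" for x y
  note lin = linear_add[OF bounded_linear.linear[OF B(2)]] linear_scale[OF bounded_linear.linear[OF B(2)]]
  have bound: "norm (ip x y) \<le> norm x * norm y * (K\<^sup>2 * (\<Sum>b\<in>B. onorm (\<phi> b) * onorm (\<phi> b)))" for x y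
  proof -
    have "norm (ip x y) \<le> K\<^sup>2 * (\<Sum>b\<in>B. \<bar>\<phi> b x\<bar> * \<bar>\<phi> b y\<bar>)"
      unfolding ip_def by (auto simp: abs_mult intro!: mult_left_mono order_trans[OF sum_abs])
    also have "\<dots> \<le> K\<^sup>2 * (\<Sum>b\<in>B. (onorm (\<phi> b) * norm x) * (onorm (\<phi> b) * norm y))"
      using onorm[OF B(2)] onorm_pos_le[OF B(2)]
      by (intro mult_left_mono sum_mono mult_mono) auto
    finally show ?thesis
      by (simp add: sum_distrib_left sum_distrib_right mult_ac)
  qed
  have "bounded_bilinear ip"
  proof (rule bounded_bilinear.intro)
    show "\<exists>K. \<forall>x y. norm (ip x y) \<le> norm x * norm y * K"
      using bound by blast
  qed (simp_all add: ip_def lin algebra_simps sum.distrib sum_distrib_left)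
  moreover have "inner_form_axioms ip m"
  proof
    fix x y
    show "ip x y = ip y x"
      by (simp add: ip_def mult.commute)
    have *: "\<bar>\<phi> b x\<bar> \<le> L2_set (\<lambda>b. \<phi> b x) B" if "b \<in> B" for b
      using member_le_L2_set[OF B(1) that, of "\<lambda>b. \<bar>\<phi> b x\<bar>"] by (simp add: L2_set_def)
    have "norm x \<le> (\<Sum>b\<in>B. norm (\<phi> b x *\<^sub>R b))"
      using norm_sum[of "\<lambda>b. \<phi> b x *\<^sub>R b" B] B(3)[of x] by simp
    also have "\<dots> \<le> (\<Sum>b\<in>B. L2_set (\<lambda>b. \<phi> b x) B * norm b)"
      using * by (intro sum_mono) (auto intro: mult_right_mono)
    also have "\<dots> \<le> L2_set (\<lambda>b. \<phi> b x) B * (1 + (\<Sum>b\<in>B. norm b))"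
      by (simp add: distrib_left flip: sum_distrib_left)
    finally have "m * norm x \<le> m * (L2_set (\<lambda>b. \<phi> b x) B * (1 + (\<Sum>b\<in>B. norm b)))"
      using assms(2) by (intro mult_left_mono) auto
    also have "\<dots> = sqrt (ip x x)"
    proof -
      have "sqrt (ip x x) = K * L2_set (\<lambda>b. \<phi> b x) B"
        using K by (simp add: ip_def L2_set_def real_sqrt_mult power2_eq_square[of "\<phi> _ x"])
      then show ?thesis by (simp add: K_def)
    qed
    finally show "m * norm x \<le> sqrt (ip x x)" .
  qed (use assms in auto)
  ultimately show thesis
    by (intro that inner_form.intro)
qed

text \<open>The lower constant is the minimum because the norm of the product type is Euclidean, so
  the two bounds add after squaring.\<close>

lemma inner_form_prod:
  assumes "inner_form ip1 m1" "inner_form ip2 m2"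
  shows "inner_form (\<lambda>p q. ip1 (fst p) (fst q) + ip2 (snd p) (snd q)) (min m1 m2)"
proof -
  interpret f1: inner_form ip1 m1 by (rule assms)
  interpret f2: inner_form ip2 m2 by (rule assms)
  have "bounded_bilinear (\<lambda>p q. ip1 (fst p) (fst q) + ip2 (snd p) (snd q))"
  proof (rule bounded_bilinear.intro)
    obtain K1 where K1: "K1 > 0" "\<And>a b. norm (ip1 a b) \<le> norm a * norm b * K1"
      using f1.pos_bounded by blast
    obtain K2 where K2: "K2 > 0" "\<And>a b. norm (ip2 a b) \<le> norm a * norm b * K2"
      using f2.pos_bounded by blast
    have "norm (ip1 (fst p) (fst q) + ip2 (snd p) (snd q)) \<le> norm p * norm q * (K1 + K2)" for p q
    proof -
      have "norm (ip1 (fst p) (fst q)) \<le> norm p * norm q * K1"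
        using norm_fst_le[of "fst p" "snd p"] norm_fst_le[of "fst q" "snd q"] K1(1)
        by (intro order_trans[OF K1(2)] mult_right_mono mult_mono) auto
      moreover have "norm (ip2 (snd p) (snd q)) \<le> norm p * norm q * K2"
        using norm_snd_le[of "snd p" "fst p"] norm_snd_le[of "snd q" "fst q"] K2(1)
        by (intro order_trans[OF K2(2)] mult_right_mono mult_mono) auto
      ultimately show ?thesis
        using norm_triangle_ineq[of "ip1 (fst p) (fst q)" "ip2 (snd p) (snd q)"]
        by (simp add: distrib_left)
    qed
    then show "\<exists>K. \<forall>p q. norm (ip1 (fst p) (fst q) + ip2 (snd p) (snd q)) \<le> norm p * norm q * K"
      by blast
  qed (simp_all add: f1.add_left f1.add_right f1.scaleR_left f1.scaleR_right
      f2.add_left f2.add_right f2.scaleR_left f2.scaleR_right algebra_simps)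
  moreover have "inner_form_axioms (\<lambda>p q. ip1 (fst p) (fst q) + ip2 (snd p) (snd q)) (min m1 m2)"
  proof
    fix p q :: "'a \<times> 'b"
    show "ip1 (fst p) (fst q) + ip2 (snd p) (snd q) = ip1 (fst q) (fst p) + ip2 (snd q) (snd p)"
      by (simp add: f1.sym f2.sym)
    define m where "m = min m1 m2"
    have m: "m > 0" "m \<le> m1" "m \<le> m2"
      using f1.m_pos f2.m_pos by (auto simp: m_def)
    have "(m * norm (fst p))\<^sup>2 \<le> ip1 (fst p) (fst p)"
    proof (rule sqrt_ge_absD)
      show "\<bar>m * norm (fst p)\<bar> \<le> sqrt (ip1 (fst p) (fst p))"
        using f1.lower[of "fst p"] m mult_right_mono[OF m(2), of "norm (fst p)"] by simp
    qed
    moreover have "(m * norm (snd p))\<^sup>2 \<le> ip2 (snd p) (snd p)"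
    proof (rule sqrt_ge_absD)
      show "\<bar>m * norm (snd p)\<bar> \<le> sqrt (ip2 (snd p) (snd p))"
        using f2.lower[of "snd p"] m mult_right_mono[OF m(3), of "norm (snd p)"] by simp
    qed
    ultimately have "(m * norm p)\<^sup>2 \<le> ip1 (fst p) (fst p) + ip2 (snd p) (snd p)"
      by (simp add: norm_prod_def power_mult_distrib distrib_left)
    then show "m * norm p \<le> sqrt (ip1 (fst p) (fst p) + ip2 (snd p) (snd p))"
      by (rule real_le_rsqrt)
  qed (use f1.m_pos f2.m_pos in auto)
  ultimately show ?thesis
    by (intro inner_form.intro)
qed

section \<open>First-order conditions for minimizing the Hilbert norm of a residual\<close>

context inner_form
begin

text \<open>Common source of the adjoint equation and of the normals: s is the Ekeland penalty of a
  move that changes the residual from y to \<open>y + h\<close>. The remainder is explicit and h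
  need not be small.\<close>

lemma first_order_inequality:
  assumes "y \<noteq> 0" and "sqrt (ip y y) \<le> sqrt (ip (y + h) (y + h)) + s"
  shows "0 \<le> ip (y /\<^sub>R sqrt (ip y y)) h + ip h h / (2 * sqrt (ip y y)) + s"
proof -
  define q where "q = sqrt (ip y y)"
  have q: "q > 0"
    using self_pos[OF assms(1)] by (simp add: q_def)
  have "0 \<le> (ip y h + ip h h / 2) / q + s"
    using assms sqrt_form_add_le[OF assms(1), of h] by (simp add: q_def)
  also have "(ip y h + ip h h / 2) / q + s = ip (y /\<^sub>R q) h + ip h h / (2 * q) + s"
    using q by (simp add: scaleR_left field_simps)
  finally show ?thesis
    by (simp add: q_def)
qed

text \<open>Along a ray the first-order inequality gives a function that vanishes at 0 and is
  nonnegative to the right, so its derivative at 0 is nonnegative; the opposite direction yields the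
  absolute value.\<close>

lemma stationary_derivative:
  fixes P :: "'x::real_normed_vector \<Rightarrow> 'a"
  assumes "(P has_derivative D) (at x)" "y \<noteq> 0"
    and min: "\<And>x'. sqrt (ip y y) \<le> sqrt (ip (y + (P x' - P x)) (y + (P x' - P x))) + \<sigma> * norm (x' - x)"
  shows "\<bar>ip (y /\<^sub>R sqrt (ip y y)) (D h)\<bar> \<le> \<sigma> * norm h"
proof -
  define v where "v = y /\<^sub>R sqrt (ip y y)"
  have nonneg: "0 \<le> ip v (D h) + \<sigma> * norm h" for h
  proof (rule ccontr)
    assume neg: "\<not> ?thesis"
    define K where "K = 1 / (2 * sqrt (ip y y))"
    define \<Delta> where "\<Delta> s = P (x + s *\<^sub>R h) - P x" for s :: real
    \<comment> \<open>The penalty contains s rather than its absolute value, so that g is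
      differentiable at 0; the two agree for positive s, where alone the sign of g is
      tested.\<close>
    define g where "g s = ip v (\<Delta> s) + ip (\<Delta> s) (\<Delta> s) * K + s * (\<sigma> * norm h)" for s
    have lin: "linear D"
      using assms(1) has_derivative_linear by blast
    have "((\<lambda>s. P (x + s *\<^sub>R h)) has_derivative (\<lambda>s. D (s *\<^sub>R h))) (at 0)"
      by (rule has_derivative_compose[of "\<lambda>s. x + s *\<^sub>R h" "\<lambda>s. s *\<^sub>R h" 0 UNIV P D])
        (use assms(1) in \<open>auto intro!: derivative_eq_intros\<close>)
    then have \<Delta>_deriv: "(\<Delta> has_derivative (\<lambda>s. s *\<^sub>R D h)) (at 0)"
      unfolding \<Delta>_def by (auto intro!: derivative_eq_intros simp: linear_scale[OF lin])
    have \<Delta>0: "\<Delta> 0 = 0"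
      by (simp add: \<Delta>_def)
    have "(g has_derivative (\<lambda>s. ip v (s *\<^sub>R D h) + s * (\<sigma> * norm h))) (at 0)"
      unfolding g_def
      by (rule derivative_eq_intros \<Delta>_deriv FDERIV bounded_linear.has_derivative[OF bounded_linear_right] refl)+
        (simp add: \<Delta>0 zero_left zero_right)
    then have "(g has_real_derivative (ip v (D h) + \<sigma> * norm h)) (at 0)"
      unfolding has_field_derivative_def
      by (rule has_derivative_eq_rhs) (simp add: scaleR_right algebra_simps fun_eq_iff)
    from DERIV_neg_dec_right[OF this] neg obtain d where d: "d > 0" "\<And>s. 0 < s \<Longrightarrow> s < d \<Longrightarrow> g s < g 0"
      by auto
    have "0 \<le> g s" if "s > 0" for s
      using first_order_inequality[OF assms(2) min[of "x + s *\<^sub>R h"]] that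
      by (simp add: g_def \<Delta>_def v_def K_def mult_ac)
    moreover have "g 0 = 0"
      by (simp add: g_def \<Delta>0 zero_left zero_right)
    ultimately show False
      using d(2)[of "d / 2"] d(1) by (smt (verit) field_sum_of_halves)
  qed
  have "D (- h) = - D h"
    using assms(1) has_derivative_linear linear_neg by blast
  with nonneg[of h] nonneg[of "- h"] show ?thesis
    by (simp add: v_def minus_right)
qed

end

section \<open>Directional neighbourhoods and normals\<close>

text \<open>The gap between \<open>\<sigma>\<close> and \<open>\<epsilon>\<close> absorbs the
  quadratic term near z, however large C is.\<close>

lemma eps_normalsI:
  assumes "z \<in> S" "C \<ge> 0" "\<sigma> < \<epsilon>"
    and bound: "\<And>w. w \<in> S \<Longrightarrow> blinfun_apply f (w - z) \<le> \<sigma> * norm (w - z) + C * (norm (w - z))\<^sup>2"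
  shows "f \<in> eps_normals \<epsilon> z S"
proof -
  have "\<forall>\<^sub>F w in at z within S. ereal (blinfun_apply f (w - z) / norm (w - z)) \<le> ereal \<epsilon>"
    unfolding eventually_at
  proof (intro exI[of _ "(\<epsilon> - \<sigma>) / (C + 1)"] conjI ballI impI)
    show "0 < (\<epsilon> - \<sigma>) / (C + 1)"
      using assms by simp
    fix w assume w: "w \<in> S" "w \<noteq> z \<and> dist w z < (\<epsilon> - \<sigma>) / (C + 1)"
    then have "(C + 1) * norm (w - z) < \<epsilon> - \<sigma>"
      using assms(2) by (simp add: dist_norm field_simps)
    then have "C * norm (w - z) \<le> \<epsilon> - \<sigma>"
      using norm_ge_zero[of "w - z"] by (simp only: distrib_right mult_1)
    then have "(\<sigma> + C * norm (w - z)) * norm (w - z) \<le> \<epsilon> * norm (w - z)"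
      by (intro mult_right_mono) auto
    with bound[OF w(1)] have "blinfun_apply f (w - z) \<le> \<epsilon> * norm (w - z)"
      by (simp add: algebra_simps power2_eq_square)
    with w show "ereal (blinfun_apply f (w - z) / norm (w - z)) \<le> ereal \<epsilon>"
      by (simp add: divide_le_eq)
  qed
  then show ?thesis
    using assms(1) by (simp add: eps_normals_def Limsup_bounded)
qed

text \<open>Translates the conic neighbourhood into difference quotients, the form in which
  directional normals are defined; a single \<open>\<tau>\<close> bounds both the step and the error
  in direction.\<close>

lemma dir_nbhd_nearby:
  fixes xbar u :: "'x::real_normed_vector"
  assumes "\<epsilon> > 0" "\<delta> > 0" "r > 0"
  obtains \<tau> where "\<tau> > 0"
    "\<And>t x. 0 < t \<Longrightarrow> t < \<tau> \<Longrightarrow> norm ((x - xbar) /\<^sub>R t - u) \<le> \<tau> \<Longrightarrow> x \<in> dir_nbhd \<epsilon> \<delta> xbar u \<and> norm (x - xbar) < r"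
proof -
  \<comment> \<open>For \<open>u = 0\<close> the angular condition is void. Otherwise
    \<open>norm u / 2\<close> keeps the quotient at least half as long as u, and
    \<open>\<delta> * norm u / 4\<close> then pays for the angular error, which is at most
    \<open>2 * \<tau> * norm u\<close>.\<close>
  define b where "b = (if u = 0 then 1 else min (norm u / 2) (\<delta> * norm u / 4))"
  define \<tau> where "\<tau> = min (min 1 b) (min \<epsilon> r / (norm u + 1))"
  have b: "b > 0"
    using assms by (auto simp: b_def)
  have nu: "norm u + 1 > 0"
    by (smt (verit) norm_ge_zero)
  have "\<tau> \<le> min \<epsilon> r / (norm u + 1)"
    by (simp add: \<tau>_def)
  then have "\<tau> * (norm u + 1) \<le> min \<epsilon> r"
    using nu by (simp add: pos_le_divide_eq)
  moreover have "\<tau> > 0" "\<tau> \<le> 1" "\<tau> \<le> b"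
    using b assms nu by (auto simp: \<tau>_def)
  ultimately have \<tau>: "\<tau> > 0" "\<tau> \<le> 1" "\<tau> \<le> b" "\<tau> * (norm u + 1) \<le> \<epsilon>" "\<tau> * (norm u + 1) \<le> r"
    by auto
  show thesis
  proof (rule that[OF \<tau>(1)])
    fix t x assume t: "0 < t" "t < \<tau>" and x: "norm ((x - xbar) /\<^sub>R t - u) \<le> \<tau>"
    define w where "w = (x - xbar) /\<^sub>R t"
    have xw: "x - xbar = t *\<^sub>R w"
      using t by (simp add: w_def)
    have wu: "norm (w - u) \<le> \<tau>"
      using x by (simp add: w_def)
    have nw: "\<bar>norm w - norm u\<bar> \<le> \<tau>"
      using wu norm_triangle_ineq3[of w u] by simp
    have "norm (x - xbar) = t * norm w"
      using t by (simp add: xw)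
    also have "\<dots> \<le> t * (norm u + 1)"
      using t nw \<tau> by (intro mult_left_mono) auto
    also have "\<dots> < \<tau> * (norm u + 1)"
      using t nu by (intro mult_strict_right_mono)
    finally have small: "norm (x - xbar) < \<tau> * (norm u + 1)" .
    have "norm (norm u *\<^sub>R w - norm w *\<^sub>R u) \<le> \<delta> * norm w * norm u"
    proof (cases "u = 0")
      case False
      have "norm u *\<^sub>R w - norm w *\<^sub>R u = norm u *\<^sub>R (w - u) + (norm u - norm w) *\<^sub>R u"
        by (simp add: algebra_simps)
      then have "norm (norm u *\<^sub>R w - norm w *\<^sub>R u) \<le> norm u * norm (w - u) + \<bar>norm u - norm w\<bar> * norm u"
        by (metis norm_triangle_ineq norm_scaleR abs_norm_cancel)
      also have "\<dots> \<le> norm u * \<tau> + \<tau> * norm u"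
        using wu nw by (intro add_mono mult_left_mono mult_right_mono) auto
      also have "\<dots> = (2 * \<tau>) * norm u"
        by simp
      also have "\<dots> \<le> (\<delta> * norm w) * norm u"
      proof (rule mult_right_mono)
        have "2 * \<tau> \<le> \<delta> * (norm u / 2)" "norm u / 2 \<le> norm w"
          using \<tau>(3) nw False by (auto simp: b_def)
        then show "2 * \<tau> \<le> \<delta> * norm w"
          using assms(2) by (meson mult_left_mono less_imp_le order_trans)
      qed simp
      finally show ?thesis .
    qed simp
    then have "t * norm (norm u *\<^sub>R w - norm w *\<^sub>R u) \<le> t * (\<delta> * norm w * norm u)"
      using t by (intro mult_left_mono) auto
    moreover have "norm u *\<^sub>R (t *\<^sub>R w) - norm (t *\<^sub>R w) *\<^sub>R u = t *\<^sub>R (norm u *\<^sub>R w - norm w *\<^sub>R u)"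
      using t by (simp add: algebra_simps)
    ultimately have "norm (norm u *\<^sub>R (x - xbar) - norm (x - xbar) *\<^sub>R u) \<le> \<delta> * norm (x - xbar) * norm u"
      using t by (simp add: xw mult_ac)
    with small \<tau> have "x \<in> dir_nbhd \<epsilon> \<delta> xbar u"
      unfolding dir_nbhd_def by (auto intro!: exI[of _ "x - xbar"])
    with small \<tau> show "x \<in> dir_nbhd \<epsilon> \<delta> xbar u \<and> norm (x - xbar) < r"
      by simp
  qed
qed

text \<open>Converse translation. The step \<open>norm (x - xbar) / a\<close> gives the quotient
  length a: for nonzero u this is the length of u, so only the angular error remains, and for
  \<open>u = 0\<close> a small length is enough.\<close>

lemma dir_nbhd_scale:
  fixes xbar u :: "'x::real_normed_vector"
  assumes "\<tau> > 0"
  obtains \<epsilon> \<delta> a where "\<epsilon> > 0" "\<delta> > 0" "a > 0"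
    "\<And>x. x \<in> dir_nbhd \<epsilon> \<delta> xbar u \<Longrightarrow> x \<noteq> xbar \<Longrightarrow>
      norm (x - xbar) / a < \<tau> \<and> norm ((x - xbar) /\<^sub>R (norm (x - xbar) / a) - u) \<le> \<tau> / 2"
proof -
  define a where "a = (if u = 0 then \<tau> / 2 else norm u)"
  define \<delta> where "\<delta> = (if u = 0 then 1 else \<tau> / (2 * norm u))"
  have a: "a > 0" and \<delta>: "\<delta> > 0"
    using assms by (auto simp: a_def \<delta>_def)
  show thesis
  proof (rule that[of "a * \<tau> / 2" \<delta> a])
    fix x assume x: "x \<in> dir_nbhd (a * \<tau> / 2) \<delta> xbar u" "x \<noteq> xbar"
    define z where "z = x - xbar"
    have z: "z \<noteq> 0" "norm z \<le> a * \<tau> / 2" "norm (norm u *\<^sub>R z - norm z *\<^sub>R u) \<le> \<delta> * norm z * norm u"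
      using x by (auto simp: dir_nbhd_def z_def)
    have "norm z < \<tau> * a"
      using z(2) mult_pos_pos[OF a assms] by (simp add: mult.commute)
    then have "norm z / a < \<tau>"
      using a by (simp add: pos_divide_less_eq)
    moreover have "norm (z /\<^sub>R (norm z / a) - u) \<le> \<tau> / 2"
    proof (cases "u = 0")
      case True
      then show ?thesis
        using z(1) assms by (simp add: a_def)
    next
      case False
      have "z /\<^sub>R (norm z / a) - u = (norm u *\<^sub>R z - norm z *\<^sub>R u) /\<^sub>R norm z"
        using z(1) False by (simp add: a_def algebra_simps divide_inverse)
      then have "norm (z /\<^sub>R (norm z / a) - u) = norm (norm u *\<^sub>R z - norm z *\<^sub>R u) / norm z"
        by (simp add: divide_inverse mult.commute)
      also have "\<dots> \<le> \<delta> * norm u"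
        using z(1,3) by (simp add: field_simps)
      also have "\<dots> = \<tau> / 2"
        using False by (simp add: \<delta>_def)
      finally show ?thesis .
    qed
    ultimately show "norm (x - xbar) / a < \<tau> \<and> norm ((x - xbar) /\<^sub>R (norm (x - xbar) / a) - u) \<le> \<tau> / 2"
      by (simp add: z_def)
  qed (use a \<delta> assms in auto)
qed

text \<open>Multipliers are handled as vectors and become functionals through \<open>ip\<close>;
  norm convergence of the vectors gives weak-star convergence of the functionals.\<close>

lemma dir_limiting_normalsI:
  fixes \<Lambda> :: "'b::real_normed_vector set"
  assumes form: "inner_form ip m"
    and t: "\<And>n. 0 < t n" "t \<longlonglongrightarrow> 0"
    and \<tau>: "\<And>n. 0 < \<tau> n" "\<tau> \<longlonglongrightarrow> 0"
    and dir: "(\<lambda>n. (z n - zbar) /\<^sub>R t n) \<longlonglongrightarrow> d"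
    and z: "\<And>n. z n \<in> \<Lambda>" and v: "v \<longlonglongrightarrow> vbar"
    and normal: "\<And>n. Blinfun (ip (v n)) \<in> eps_normals (\<tau> n) (z n) \<Lambda>"
  shows "Blinfun (ip vbar) \<in> dir_limiting_normals zbar \<Lambda> d"
proof -
  interpret inner_form ip m by (rule form)
  have "weak_star_tendsto (\<lambda>n. Blinfun (ip (v n))) (Blinfun (ip vbar))"
    unfolding weak_star_tendsto_def
    by (simp add: bounded_linear_Blinfun_apply bounded_linear_right tendsto[OF v tendsto_const])
  moreover have "zbar + t n *\<^sub>R ((z n - zbar) /\<^sub>R t n) = z n" for n
    using t(1)[of n] by simp
  ultimately show ?thesis
    unfolding dir_limiting_normals_def null_seq_pos_def mem_Collect_eq
    using t \<tau> dir z normal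
    by (intro exI[of _ \<tau>] exI[of _ t] exI[of _ "\<lambda>n. (z n - zbar) /\<^sub>R t n"] exI[of _ "\<lambda>n. Blinfun (ip (v n))"])
      simp
qed

text \<open>Directional normals are attached to points of the constraint set, not to x. The residual
  is o(t), so these points leave \<open>P xbar\<close> in the same direction as
  \<open>P (x n)\<close> does.\<close>

lemma directional_image:
  fixes P :: "'x::real_normed_vector \<Rightarrow> 'a::real_normed_vector"
  assumes deriv: "(P has_derivative D) (at xbar)"
    and t: "\<And>n. 0 < t n" "t \<longlonglongrightarrow> 0"
    and \<tau>: "\<tau> \<longlonglongrightarrow> 0"
    and x: "(\<lambda>n. (x n - xbar) /\<^sub>R t n) \<longlonglongrightarrow> u"
    and z: "\<And>n. norm (P (x n) - z n) \<le> \<tau> n * t n"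
  shows "(\<lambda>n. (z n - P xbar) /\<^sub>R t n) \<longlonglongrightarrow> D u"
proof -
  define w where "w n = (x n - xbar) /\<^sub>R t n" for n
  have xw: "x n = xbar + t n *\<^sub>R w n" for n
    using t(1)[of n] by (simp add: w_def)
  have w: "w \<longlonglongrightarrow> u"
    using x by (simp add: w_def[abs_def])
  have xlim: "x \<longlonglongrightarrow> xbar"
    unfolding xw[abs_def] using tendsto_add[OF tendsto_const tendsto_scaleR[OF t(2) w]] by simp
  have lin: "linear D"
    using deriv has_derivative_linear by blast
  \<comment> \<open>Normalized remainder. Division by zero gives \<open>R xbar = 0\<close>, so the
    punctured limit becomes continuity at \<open>xbar\<close> and the sequence may hit
    \<open>xbar\<close>.\<close>
  define R where "R y = (1 / norm (y - xbar)) *\<^sub>R (P y - (P xbar + D (y - xbar)))" for y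
  have "(R \<longlongrightarrow> 0) (at xbar)"
    using deriv unfolding R_def has_derivative_within by blast
  then have "isCont R xbar"
    by (simp add: isCont_def R_def)
  then have "(\<lambda>n. R (x n)) \<longlonglongrightarrow> 0"
    using isCont_tendsto_compose[OF _ xlim, of R] by (simp add: R_def)
  moreover have "(\<lambda>n. norm (w n)) \<longlonglongrightarrow> norm u"
    by (intro tendsto_intros w)
  ultimately have rem: "(\<lambda>n. norm (w n) *\<^sub>R R (x n)) \<longlonglongrightarrow> 0"
    using tendsto_scaleR by fastforce
  have Dw: "(\<lambda>n. D (w n)) \<longlonglongrightarrow> D u"
    using bounded_linear.tendsto[OF has_derivative_bounded_linear[OF deriv] w] .
  have "(P (x n) - P xbar) /\<^sub>R t n = D (w n) + norm (w n) *\<^sub>R R (x n)" for n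
  proof -
    have "norm (x n - xbar) *\<^sub>R R (x n) = P (x n) - P xbar - D (x n - xbar)"
      by (cases "x n = xbar") (simp_all add: R_def linear_0[OF lin])
    moreover have "norm (x n - xbar) = t n * norm (w n)" "D (x n - xbar) = t n *\<^sub>R D (w n)"
      using t(1)[of n] by (simp_all add: xw linear_scale[OF lin])
    ultimately have "P (x n) - P xbar = t n *\<^sub>R (D (w n) + norm (w n) *\<^sub>R R (x n))"
      by (simp add: algebra_simps)
    then show ?thesis
      using t(1)[of n] by simp
  qed
  then have "(\<lambda>n. (P (x n) - P xbar) /\<^sub>R t n) \<longlonglongrightarrow> D u"
    using tendsto_add[OF Dw rem] by simp
  moreover have "(\<lambda>n. (P (x n) - z n) /\<^sub>R t n) \<longlonglongrightarrow> 0"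
  proof (rule Lim_null_comparison[OF always_eventually \<tau>], intro allI)
    show "norm ((P (x n) - z n) /\<^sub>R t n) \<le> \<tau> n" for n
    proof -
      have "norm ((P (x n) - z n) /\<^sub>R t n) = norm (P (x n) - z n) / t n"
        using t(1)[of n] by (simp add: divide_inverse mult.commute)
      also have "\<dots> \<le> \<tau> n"
        using z[of n] t(1)[of n] by (simp add: pos_divide_le_eq)
      finally show ?thesis .
    qed
  qed
  ultimately have "(\<lambda>n. (P (x n) - P xbar) /\<^sub>R t n - (P (x n) - z n) /\<^sub>R t n) \<longlonglongrightarrow> D u"
    using tendsto_diff by fastforce
  then show ?thesis
    by (simp add: algebra_simps)
qed

section \<open>Approximate multipliers\<close>

text \<open>If the second component were below half of the whole, one could jump to a point x'
  satisfying the first constraint and take \<open>P1 x'\<close> as the new first target. The first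
  residual disappears, and everything else costs at most a multiple of
  \<open>norm (P1 x - z1)\<close>, which the size of \<open>m1\<close> makes smaller than the
  gain.\<close>

lemma multiplier_second_component_ge:
  fixes P1 :: "'x::real_normed_vector \<Rightarrow> 'a::real_normed_vector" and P2 :: "'x \<Rightarrow> 'b::real_normed_vector"
  assumes form1: "inner_form ip1 m1" and form2: "inner_form ip2 m2"
    and z: "z1 \<in> \<Lambda>1" "z2 \<in> \<Lambda>2"
    and min: "\<And>x' w1 w2. w1 \<in> \<Lambda>1 \<Longrightarrow> w2 \<in> \<Lambda>2 \<Longrightarrow>
      sqrt (ip1 (P1 x - z1) (P1 x - z1) + ip2 (P2 x - z2) (P2 x - z2))
        \<le> sqrt (ip1 (P1 x' - w1) (P1 x' - w1) + ip2 (P2 x' - w2) (P2 x' - w2))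
          + \<sigma> * dist (x, z1, z2) (x', w1, w2)"
    and \<sigma>: "0 \<le> \<sigma>" "\<sigma> \<le> 1"
    and near: "P1 x \<noteq> z1 \<Longrightarrow> \<exists>x'. P1 x' \<in> \<Lambda>1 \<and> norm (x' - x) \<le> \<kappa> * norm (P1 x - z1) \<and>
      norm (P1 x' - P1 x) \<le> L * norm (x' - x) \<and> norm (P2 x' - P2 x) \<le> L * norm (x' - x)"
    and C2: "\<And>y. sqrt (ip2 y y) \<le> C2 * norm y" "C2 \<ge> 0"
    and L: "L \<ge> 0"
    and m1: "2 * (C2 * L * \<kappa> + \<kappa> + 1 + L * \<kappa>) \<le> m1"
  shows "sqrt (ip1 (P1 x - z1) (P1 x - z1) + ip2 (P2 x - z2) (P2 x - z2)) / 2
    \<le> sqrt (ip2 (P2 x - z2) (P2 x - z2))"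
proof (rule ccontr)
  interpret f1: inner_form ip1 m1 by (rule form1)
  interpret f2: inner_form ip2 m2 by (rule form2)
  define y1 where "y1 = P1 x - z1"
  define y2 where "y2 = P2 x - z2"
  define q where "q = sqrt (ip1 y1 y1 + ip2 y2 y2)"
  \<comment> \<open>Cost of the jump per unit of \<open>norm y1\<close>:
    \<open>C2 * L * \<kappa>\<close> for the growth of the second residual, \<open>\<kappa>\<close>
    for moving x, and \<open>1 + L * \<kappa>\<close> for moving \<open>z1\<close> to
    \<open>P1 x'\<close>.\<close>
  define K where "K = C2 * L * \<kappa> + \<kappa> + 1 + L * \<kappa>"
  assume "\<not> ?thesis"
  then have less: "sqrt (ip2 y2 y2) < q / 2"
    by (simp add: y1_def y2_def q_def)
  have q_le: "q \<le> sqrt (ip1 y1 y1) + sqrt (ip2 y2 y2)"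
    unfolding q_def using f1.self_nonneg f2.self_nonneg by (rule sqrt_add_le_add_sqrt)
  have "y1 \<noteq> 0"
  proof
    assume "y1 = 0"
    with q_le have "q \<le> sqrt (ip2 y2 y2)"
      by (simp add: f1.zero_left)
    with less real_sqrt_ge_zero[OF f2.self_nonneg[of y2]] show False by linarith
  qed
  then obtain x' where x': "P1 x' \<in> \<Lambda>1" "norm (x' - x) \<le> \<kappa> * norm y1"
      "norm (P1 x' - P1 x) \<le> L * norm (x' - x)" "norm (P2 x' - P2 x) \<le> L * norm (x' - x)"
    using near by (auto simp: y1_def)
  have Lx: "L * norm (x' - x) \<le> L * \<kappa> * norm y1"
    using mult_left_mono[OF x'(2) L] by simp
  have "P2 x' - z2 = y2 + (P2 x' - P2 x)"
    by (simp add: y2_def)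
  then have "sqrt (ip2 (P2 x' - z2) (P2 x' - z2)) \<le> sqrt (ip2 y2 y2) + sqrt (ip2 (P2 x' - P2 x) (P2 x' - P2 x))"
    using f2.sqrt_form_triangle by metis
  also have "sqrt (ip2 (P2 x' - P2 x) (P2 x' - P2 x)) \<le> C2 * (L * \<kappa> * norm y1)"
    by (rule order_trans[OF C2(1)]) (use x'(4) Lx C2(2) in \<open>auto intro: mult_left_mono\<close>)
  finally have q2: "sqrt (ip2 (P2 x' - z2) (P2 x' - z2)) \<le> sqrt (ip2 y2 y2) + C2 * L * \<kappa> * norm y1"
    by (simp add: mult_ac)
  have "dist (x, z1, z2) (x', P1 x', z2) \<le> norm (x' - x) + norm (P1 x' - z1)"
    using norm_Pair_le[of "x - x'" "(z1 - P1 x', 0)"] norm_Pair_le[of "z1 - P1 x'" 0]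
    by (simp add: dist_norm norm_minus_commute)
  also have "norm (P1 x' - z1) \<le> norm (P1 x' - P1 x) + norm y1"
    using norm_triangle_ineq[of "P1 x' - P1 x" y1] by (simp add: y1_def)
  finally have d: "dist (x, z1, z2) (x', P1 x', z2) \<le> (\<kappa> + 1 + L * \<kappa>) * norm y1"
    using x' Lx by (simp add: distrib_right)
  have "q \<le> sqrt (ip1 (P1 x' - P1 x') (P1 x' - P1 x') + ip2 (P2 x' - z2) (P2 x' - z2))
      + \<sigma> * dist (x, z1, z2) (x', P1 x', z2)"
    unfolding q_def y1_def y2_def by (rule min[OF x'(1) z(2)])
  also have "\<sigma> * dist (x, z1, z2) (x', P1 x', z2) \<le> (\<kappa> + 1 + L * \<kappa>) * norm y1"
    using \<sigma> d mult_right_mono[OF \<sigma>(2), of "dist (x, z1, z2) (x', P1 x', z2)"] by simp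
  finally have "q \<le> sqrt (ip2 y2 y2) + K * norm y1"
    using q2 by (simp add: f1.zero_left K_def distrib_right)
  then have "q < 2 * K * norm y1"
    using less by simp
  also have "\<dots> \<le> m1 * norm y1"
    using m1 by (intro mult_right_mono) (auto simp: K_def)
  also have "\<dots> \<le> sqrt (ip1 y1 y1)"
    by (rule f1.lower)
  also have "\<dots> \<le> q"
    unfolding q_def using f2.self_nonneg by simp
  finally show False by simp
qed

section \<open>Pointwise consequences of subregularity and of its failure\<close>

lemma not_subregular_witness:
  assumes "\<not> metrically_subregular_dir sum_norm (\<lambda>x. constraint_map P1 \<Lambda>1 x \<times> constraint_map P2 \<Lambda>2 x) xbar (0, 0) u"
    and "P1 xbar \<in> \<Lambda>1" "P2 xbar \<in> \<Lambda>2" and pos: "\<epsilon> > 0" "\<delta> > 0" "\<kappa> > 0"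
  shows "\<exists>x\<in>dir_nbhd \<epsilon> \<delta> xbar u. \<exists>z1\<in>\<Lambda>1. \<exists>z2\<in>\<Lambda>2. \<forall>x'. P1 x' \<in> \<Lambda>1 \<longrightarrow> P2 x' \<in> \<Lambda>2 \<longrightarrow>
    \<kappa> * (norm (P1 x - z1) + norm (P2 x - z2)) < norm (x - x')"
proof (rule ccontr)
  assume neg: "\<not> ?thesis"
  define S where "S = {x. (0, 0) \<in> constraint_map P1 \<Lambda>1 x \<times> constraint_map P2 \<Lambda>2 x}"
  have S: "x \<in> S \<longleftrightarrow> P1 x \<in> \<Lambda>1 \<and> P2 x \<in> \<Lambda>2" for x
    by (auto simp: S_def constraint_map_def)
  have "dist_to_set norm x S
      \<le> ereal \<kappa> * dist_to_set sum_norm (0, 0) (constraint_map P1 \<Lambda>1 x \<times> constraint_map P2 \<Lambda>2 x)"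
    if x: "x \<in> dir_nbhd \<epsilon> \<delta> xbar u" for x
  proof -
    \<comment> \<open>With \<open>\<kappa>\<close> moved to the left, the bound is checked for each
      residual separately, so no nearest point of the image has to exist.\<close>
    have "dist_to_set norm x S / ereal \<kappa>
        \<le> dist_to_set sum_norm (0, 0) (constraint_map P1 \<Lambda>1 x \<times> constraint_map P2 \<Lambda>2 x)"
      unfolding dist_to_set_def[of sum_norm]
    proof (rule INF_greatest)
      fix w assume "w \<in> constraint_map P1 \<Lambda>1 x \<times> constraint_map P2 \<Lambda>2 x"
      then obtain z1 z2 where w: "w = (P1 x - z1, P2 x - z2)" "z1 \<in> \<Lambda>1" "z2 \<in> \<Lambda>2"
        by (auto simp: constraint_map_def)
      with neg x obtain x' where x': "x' \<in> S" "norm (x - x') \<le> \<kappa> * (norm (P1 x - z1) + norm (P2 x - z2))"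
        unfolding S by (meson not_less)
      have "dist_to_set norm x S \<le> ereal (norm (x - x'))"
        unfolding dist_to_set_def by (rule INF_lower[OF x'(1)])
      also have "\<dots> \<le> ereal \<kappa> * ereal (sum_norm ((0, 0) - w))"
        using x'(2) by (simp add: w sum_norm_def norm_minus_commute)
      finally show "dist_to_set norm x S / ereal \<kappa> \<le> ereal (sum_norm ((0, 0) - w))"
        using pos by (subst ereal_divide_le_pos) auto
    qed
    then show ?thesis
      using pos by (subst (asm) ereal_divide_le_pos) auto
  qed
  then have "metrically_subregular_dir sum_norm (\<lambda>x. constraint_map P1 \<Lambda>1 x \<times> constraint_map P2 \<Lambda>2 x) xbar (0, 0) u"
    using S[of xbar] assms(2,3) pos unfolding metrically_subregular_dir_def S_def by blast
  with assms(1) show False by blast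
qed

lemma subregular_solution:
  assumes "metrically_subregular_dir norm (constraint_map P \<Lambda>) xbar 0 u"
  obtains \<epsilon> \<delta> \<kappa> where "\<epsilon> > 0" "\<delta> > 0" "\<kappa> > 0"
    "\<And>x z. x \<in> dir_nbhd \<epsilon> \<delta> xbar u \<Longrightarrow> z \<in> \<Lambda> \<Longrightarrow> P x \<noteq> z \<Longrightarrow>
      \<exists>x'. P x' \<in> \<Lambda> \<and> norm (x' - x) \<le> \<kappa> * norm (P x - z)"
proof -
  obtain \<epsilon> \<delta> \<kappa> where pos: "\<epsilon> > 0" "\<delta> > 0" "\<kappa> > 0" and
    sub: "\<And>x. x \<in> dir_nbhd \<epsilon> \<delta> xbar u \<Longrightarrow>
      dist_to_set norm x {x'. 0 \<in> constraint_map P \<Lambda> x'} \<le> ereal \<kappa> * dist_to_set norm 0 (constraint_map P \<Lambda> x)"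
    using assms unfolding metrically_subregular_dir_def by blast
  show thesis
  \<comment> \<open>Doubling \<open>\<kappa>\<close> makes the inequality strict, since the residual
    is nonzero; this yields an actual solution although the distance need not be attained.\<close>
  proof (rule that[of \<epsilon> \<delta> "2 * \<kappa>"])
    fix x z assume x: "x \<in> dir_nbhd \<epsilon> \<delta> xbar u" and z: "z \<in> \<Lambda>" "P x \<noteq> z"
    have "P x - z \<in> constraint_map P \<Lambda> x"
      using z by (auto simp: constraint_map_def)
    then have "dist_to_set norm 0 (constraint_map P \<Lambda> x) \<le> ereal (norm (0 - (P x - z)))"
      unfolding dist_to_set_def by (rule INF_lower)
    then have "ereal \<kappa> * dist_to_set norm 0 (constraint_map P \<Lambda> x) \<le> ereal \<kappa> * ereal (norm (P x - z))"
      using pos by (intro ereal_mult_left_mono) (auto simp: norm_minus_commute)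
    also have "\<dots> < ereal (2 * \<kappa> * norm (P x - z))"
      using pos z by simp
    finally have "dist_to_set norm x {x'. 0 \<in> constraint_map P \<Lambda> x'} < ereal (2 * \<kappa> * norm (P x - z))"
      using sub[OF x] by (rule le_less_trans[rotated])
    then obtain x' where "0 \<in> constraint_map P \<Lambda> x'" "norm (x - x') < 2 * \<kappa> * norm (P x - z)"
      unfolding dist_to_set_def INF_less_iff by auto
    then show "\<exists>x'. P x' \<in> \<Lambda> \<and> norm (x' - x) \<le> 2 * \<kappa> * norm (P x - z)"
      by (intro exI[of _ x']) (auto simp: constraint_map_def norm_minus_commute)
  qed (use pos in auto)
qed

text \<open>The mean value inequality on a ball where the gradient stays within 1 of its value at
  \<open>xbar\<close>.\<close>

lemma cont_frechet_differentiable_lipschitz: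
  fixes P :: "'x::real_normed_vector \<Rightarrow> 'a::real_normed_vector"
  assumes "cont_frechet_differentiable_at P xbar"
  obtains r L where "r > 0" "L \<ge> 0"
    "\<And>x. x \<in> ball xbar r \<Longrightarrow> (P has_derivative blinfun_apply (frechet_grad P x)) (at x)"
    "\<And>x x'. x \<in> ball xbar r \<Longrightarrow> x' \<in> ball xbar r \<Longrightarrow> norm (P x - P x') \<le> L * norm (x - x')"
proof -
  obtain r1 where r1: "r1 > 0" "\<And>x. dist x xbar < r1 \<Longrightarrow> P differentiable (at x)"
    using assms unfolding cont_frechet_differentiable_at_def eventually_nhds_metric by blast
  obtain r2 where r2: "r2 > 0" "\<And>x. dist x xbar < r2 \<Longrightarrow> dist (frechet_grad P x) (frechet_grad P xbar) < 1"
    using assms unfolding cont_frechet_differentiable_at_def continuous_at_eps_delta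
    by (metis zero_less_one)
  define r where "r = min r1 r2"
  define L where "L = norm (frechet_grad P xbar) + 1"
  have deriv: "(P has_derivative blinfun_apply (frechet_grad P x)) (at x)" if "x \<in> ball xbar r" for x
  proof -
    have *: "(P has_derivative frechet_derivative P (at x)) (at x)"
      using r1(2)[of x] that frechet_derivative_works by (auto simp: r_def dist_commute)
    then show ?thesis
      using bounded_linear_Blinfun_apply[OF has_derivative_bounded_linear[OF *]] *
      by (simp add: frechet_grad_def)
  qed
  have bound: "onorm (blinfun_apply (frechet_grad P w)) \<le> L" if "w \<in> ball xbar r" for w
  proof -
    have "norm (frechet_grad P w - frechet_grad P xbar) < 1"
      using that r2(2)[of w] by (simp add: r_def dist_norm norm_minus_commute)
    then show ?thesis
      using norm_triangle_ineq2[of "frechet_grad P w" "frechet_grad P xbar"]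
      by (simp add: L_def norm_blinfun.rep_eq)
  qed
  show thesis
  proof (rule that[OF _ _ deriv])
    show "norm (P x - P x') \<le> L * norm (x - x')" if "x \<in> ball xbar r" "x' \<in> ball xbar r" for x x'
      by (rule differentiable_bound[OF convex_ball has_derivative_at_withinI[OF deriv] bound that])
  qed (use r1 r2 in \<open>auto simp: r_def L_def\<close>)
qed

text \<open>Treats one tolerance \<open>\<tau>\<close> at a time and collects everything that must
  pass to the limit. The vectors \<open>v1\<close> and \<open>v2\<close> are the components of the
  residual at the Ekeland point, divided by its Hilbert norm.\<close>

lemma approximate_multipliers:
  fixes P1 :: "'x::banach \<Rightarrow> 'a::real_normed_vector" and P2 :: "'x \<Rightarrow> 'b::real_normed_vector"
    and D1 :: "'x \<Rightarrow> 'x \<Rightarrow> 'a" and D2 :: "'x \<Rightarrow> 'x \<Rightarrow> 'b"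
  assumes form1: "inner_form ip1 m1" and form2: "inner_form ip2 m2"
    and cont: "continuous_on UNIV P1" "continuous_on UNIV P2"
    and complete: "complete \<Lambda>1" "complete \<Lambda>2"
    and xbar: "P1 xbar \<in> \<Lambda>1" "P2 xbar \<in> \<Lambda>2"
    and r: "r > 0" and L: "L \<ge> 0"
    and deriv: "\<And>x. x \<in> ball xbar r \<Longrightarrow> (P1 has_derivative D1 x) (at x)"
      "\<And>x. x \<in> ball xbar r \<Longrightarrow> (P2 has_derivative D2 x) (at x)"
    and lip: "\<And>x x'. x \<in> ball xbar r \<Longrightarrow> x' \<in> ball xbar r \<Longrightarrow> norm (P1 x - P1 x') \<le> L * norm (x - x')"
      "\<And>x x'. x \<in> ball xbar r \<Longrightarrow> x' \<in> ball xbar r \<Longrightarrow> norm (P2 x - P2 x') \<le> L * norm (x - x')"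
    and pos: "\<epsilon> > 0" "\<delta> > 0" "\<kappa> > 0"
    and subreg: "\<And>x z. x \<in> dir_nbhd \<epsilon> \<delta> xbar u \<Longrightarrow> z \<in> \<Lambda>1 \<Longrightarrow> P1 x \<noteq> z \<Longrightarrow>
      \<exists>x'. P1 x' \<in> \<Lambda>1 \<and> norm (x' - x) \<le> \<kappa> * norm (P1 x - z)"
    and C2: "\<And>y. sqrt (ip2 y y) \<le> C2 * norm y" "C2 \<ge> 0"
    and m1: "2 * (C2 * L * \<kappa> + \<kappa> + 1 + L * \<kappa>) \<le> m1"
    and not_subreg: "\<And>\<epsilon> \<delta> \<kappa>. \<epsilon> > 0 \<Longrightarrow> \<delta> > 0 \<Longrightarrow> \<kappa> > 0 \<Longrightarrow>
      \<exists>x\<in>dir_nbhd \<epsilon> \<delta> xbar u. \<exists>z1\<in>\<Lambda>1. \<exists>z2\<in>\<Lambda>2. \<forall>x'. P1 x' \<in> \<Lambda>1 \<longrightarrow> P2 x' \<in> \<Lambda>2 \<longrightarrow>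
        \<kappa> * (norm (P1 x - z1) + norm (P2 x - z2)) < norm (x - x')"
    and \<tau>: "\<tau> > 0"
  shows "\<exists>t x z1 z2 v1 v2. 0 < t \<and> t < \<tau> \<and> norm ((x - xbar) /\<^sub>R t - u) \<le> \<tau> \<and> x \<in> ball xbar r \<and>
    z1 \<in> \<Lambda>1 \<and> z2 \<in> \<Lambda>2 \<and> norm (P1 x - z1) \<le> \<tau> * t \<and> norm (P2 x - z2) \<le> \<tau> * t \<and>
    sqrt (ip1 v1 v1) \<le> 1 \<and> sqrt (ip2 v2 v2) \<le> 1 \<and> 1 / 2 \<le> sqrt (ip2 v2 v2) \<and>
    (\<forall>h. \<bar>ip1 v1 (D1 x h) + ip2 v2 (D2 x h)\<bar> \<le> \<tau> * norm h) \<and>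
    Blinfun (ip1 v1) \<in> eps_normals \<tau> z1 \<Lambda>1 \<and> Blinfun (ip2 v2) \<in> eps_normals \<tau> z2 \<Lambda>2"
proof -
  interpret f1: inner_form ip1 m1 by (rule form1)
  interpret f2: inner_form ip2 m2 by (rule form2)
  define m where "m = min m1 m2"
  define ip where "ip p q = ip1 (fst p) (fst q) + ip2 (snd p) (snd q)" for p q
  interpret f: inner_form ip m
    using inner_form_prod[OF form1 form2] unfolding ip_def[abs_def] m_def .
  obtain C where C: "C > 0" "\<And>y. sqrt (ip y y) \<le> C * norm y"
    by (rule f.upper) blast
  obtain \<tau>0 where \<tau>0: "\<tau>0 > 0" "\<And>t x. 0 < t \<Longrightarrow> t < \<tau>0 \<Longrightarrow> norm ((x - xbar) /\<^sub>R t - u) \<le> \<tau>0 \<Longrightarrow>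
      x \<in> dir_nbhd \<epsilon> \<delta> xbar u \<and> norm (x - xbar) < r / 2"
    by (rule dir_nbhd_nearby[OF pos(1,2), of "r / 2" xbar u]) (use r in auto)
  \<comment> \<open>The bound \<open>\<tau>0\<close> keeps the minimizer where the first constraint
    is subregular, and \<open>r / (2 * \<kappa>)\<close> keeps the corrected point x' in the ball
    where the Lipschitz bounds hold.\<close>
  define s where "s = min (min 1 \<tau>) (min \<tau>0 (r / (2 * \<kappa>)))"
  have s: "s > 0" "s \<le> 1" "s \<le> \<tau>" "s \<le> \<tau>0" "\<kappa> * s \<le> r / 2"
  proof -
    have "s \<le> r / (2 * \<kappa>)" by (simp add: s_def)
    then show "\<kappa> * s \<le> r / 2" using pos by (simp add: field_simps)
  qed (use \<tau> \<tau>0 r pos in \<open>auto simp: s_def\<close>)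
  define \<sigma> where "\<sigma> = s / 2"
  have \<sigma>: "\<sigma> > 0" "\<sigma> \<le> 1" "\<sigma> < \<tau>"
    using s by (auto simp: \<sigma>_def)
  obtain \<epsilon>0 \<delta>0 a where a: "\<epsilon>0 > 0" "\<delta>0 > 0" "a > 0"
    "\<And>x. x \<in> dir_nbhd \<epsilon>0 \<delta>0 xbar u \<Longrightarrow> x \<noteq> xbar \<Longrightarrow>
      norm (x - xbar) / a < s \<and> norm ((x - xbar) /\<^sub>R (norm (x - xbar) / a) - u) \<le> s / 2"
    using dir_nbhd_scale[OF s(1), of xbar u] by metis
  \<comment> \<open>Target ratio of the starting residual to t: \<open>\<sigma> * s / 2\<close>
    limits the Ekeland displacement to \<open>s / 2 * t\<close>, and \<open>m * s\<close> limits the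
    residual norm at the minimizer to \<open>s * t\<close>.\<close>
  define \<mu> where "\<mu> = min (\<sigma> * s / 2) (m * s)"
  have \<mu>: "\<mu> > 0" "\<mu> \<le> \<sigma> * s / 2" "\<mu> \<le> m * s"
    using \<sigma> s f.m_pos by (auto simp: \<mu>_def)
  \<comment> \<open>The first summand puts every solution beyond the reach of the Ekeland step; the
    second brings the starting residual below \<open>\<mu> * t\<close>, where t will be
    \<open>norm (x0 - xbar) / a\<close>.\<close>
  define K where "K = C / \<sigma> + C * a / \<mu>"
  have K: "K > 0" "C \<le> \<sigma> * K" "C * a \<le> \<mu> * K"
  proof -
    have "C / \<sigma> > 0" "C * a / \<mu> > 0"
      using C(1) \<sigma>(1) a(3) \<mu>(1) by simp_all
    then have "K > 0" "C / \<sigma> \<le> K" "C * a / \<mu> \<le> K"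
      by (auto simp: K_def)
    then show "K > 0" "C \<le> \<sigma> * K" "C * a \<le> \<mu> * K"
      using \<sigma>(1) \<mu>(1) by (simp_all add: pos_divide_le_eq mult.commute)
  qed
  obtain x0 w1 w2 where x0: "x0 \<in> dir_nbhd \<epsilon>0 \<delta>0 xbar u" and w: "w1 \<in> \<Lambda>1" "w2 \<in> \<Lambda>2" and
    far: "\<And>x'. P1 x' \<in> \<Lambda>1 \<Longrightarrow> P2 x' \<in> \<Lambda>2 \<Longrightarrow>
      K * (norm (P1 x0 - w1) + norm (P2 x0 - w2)) < norm (x0 - x')"
    using not_subreg[OF a(1,2) K(1)] by blast
  define e where "e = norm (P1 x0 - w1) + norm (P2 x0 - w2)"
  \<comment> \<open>Since \<open>xbar\<close> is itself a solution, the failure of subregularity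
    also compares the residual with the distance to \<open>xbar\<close>, that is, with a multiple of
    t.\<close>
  have e: "e \<ge> 0" "K * e < norm (x0 - xbar)"
    using far[OF xbar] by (auto simp: e_def)
  then have "x0 \<noteq> xbar"
    using K(1) by (metis diff_self norm_zero mult_nonneg_nonneg less_imp_le not_less)
  define t where "t = norm (x0 - xbar) / a"
  have t: "t > 0" "t < s" "norm ((x0 - xbar) /\<^sub>R t - u) \<le> s / 2"
    using a(3) a(4)[OF x0 \<open>x0 \<noteq> xbar\<close>] \<open>x0 \<noteq> xbar\<close> by (auto simp: t_def)
  define f where "f = (\<lambda>(x, z1, z2). sqrt (ip (P1 x - z1, P2 x - z2) (P1 x - z1, P2 x - z2)))"
  define X where "X = (UNIV :: 'x set) \<times> \<Lambda>1 \<times> \<Lambda>2"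
  have "norm (P1 x0 - w1, P2 x0 - w2) \<le> e"
    unfolding e_def by (rule norm_Pair_le)
  then have f0: "f (x0, w1, w2) \<le> C * e"
    unfolding f_def prod.case by (intro order_trans[OF C(2)] mult_left_mono) (use C(1) in auto)
  have f0_small: "f (x0, w1, w2) \<le> \<mu> * t"
  proof -
    have "(C * e) * a \<le> (\<mu> * K) * e"
      using mult_right_mono[OF K(3) e(1)] by (simp add: mult_ac)
    also have "\<dots> \<le> \<mu> * norm (x0 - xbar)"
      using mult_left_mono[of "K * e" "norm (x0 - xbar)" \<mu>] e(2) \<mu>(1) by (simp add: mult_ac)
    finally have "C * e \<le> \<mu> * t"
      using a(3) by (simp add: t_def field_simps)
    with f0 show ?thesis by simp
  qed
  have "continuous_on X f"
    unfolding f_def case_prod_beta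
    by (intro continuous_intros f.continuous_on continuous_on_compose2[OF cont(1)] continuous_on_compose2[OF cont(2)]) auto
  moreover have "complete X"
    unfolding X_def by (intro complete_Times complete complete_UNIV)
  moreover have "0 \<le> f p" for p
    using f.self_nonneg by (auto simp: f_def split: prod.split)
  moreover have "(x0, w1, w2) \<in> X"
    using w by (simp add: X_def)
  ultimately obtain p where p: "p \<in> X" "f p + \<sigma> * dist (x0, w1, w2) p \<le> f (x0, w1, w2)"
    "\<And>p'. p' \<in> X \<Longrightarrow> f p \<le> f p' + \<sigma> * dist p p'"
    using ekeland_variational_principle[of X f 0 "(x0, w1, w2)" \<sigma>] \<sigma>(1) by metis
  obtain x z1 z2 where p_eq: "p = (x, z1, z2)"
    by (cases p)
  have z: "z1 \<in> \<Lambda>1" "z2 \<in> \<Lambda>2"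
    using p(1) by (auto simp: p_eq X_def)
  define y where "y = (P1 x - z1, P2 x - z2)"
  define q where "q = sqrt (ip y y)"
  have fp: "f p = q"
    by (simp add: f_def p_eq q_def y_def)
  have min: "q \<le> sqrt (ip (P1 x' - z1', P2 x' - z2') (P1 x' - z1', P2 x' - z2')) + \<sigma> * dist (x, z1, z2) (x', z1', z2')"
    if "z1' \<in> \<Lambda>1" "z2' \<in> \<Lambda>2" for x' z1' z2'
    using p(3)[of "(x', z1', z2')"] that unfolding fp by (simp add: p_eq X_def f_def)
  have "q \<ge> 0"
    using f.self_nonneg by (simp add: q_def)
  have dist_x: "\<sigma> * norm (x0 - x) + q \<le> f (x0, w1, w2)"
  proof -
    have "\<sigma> * norm (x0 - x) \<le> \<sigma> * dist (x0, w1, w2) p"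
      using dist_fst_le[of "(x0, w1, w2)" p] \<sigma>(1) by (intro mult_left_mono) (auto simp: p_eq dist_norm)
    with p(2) show ?thesis by (simp add: fp)
  qed
  \<comment> \<open>At a solution \<open>K * e < norm (x0 - x)\<close>, while the Ekeland estimate
    allows at most \<open>C * e / \<sigma>\<close>, which does not exceed
    \<open>K * e\<close>.\<close>
  have "y \<noteq> 0"
  proof
    assume "y = 0"
    then have "K * e < norm (x0 - x)"
      using z far[of x] by (simp add: y_def zero_prod_def e_def)
    then have "\<sigma> * (K * e) < \<sigma> * norm (x0 - x)"
      using \<sigma>(1) by simp
    moreover have "C * e \<le> \<sigma> * (K * e)"
      using mult_right_mono[OF K(2) e(1)] by simp
    ultimately show False
      using dist_x f0 \<open>q \<ge> 0\<close> by linarith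
  qed
  then have q: "q > 0"
    using f.self_pos by (simp add: q_def)
  have "\<sigma> * norm (x0 - x) \<le> \<sigma> * (s / 2 * t)"
  proof -
    have "\<sigma> * norm (x0 - x) \<le> \<mu> * t"
      using dist_x \<open>q \<ge> 0\<close> f0_small by linarith
    also have "\<dots> \<le> \<sigma> * s / 2 * t"
      using \<mu>(2) t(1) by (intro mult_right_mono) auto
    finally show ?thesis by simp
  qed
  then have x_near: "norm (x0 - x) \<le> s / 2 * t"
    using \<sigma>(1) by simp
  have x_dir: "norm ((x - xbar) /\<^sub>R t - u) \<le> s"
  proof -
    have "(x - xbar) /\<^sub>R t - u = ((x0 - xbar) /\<^sub>R t - u) - (x0 - x) /\<^sub>R t"
      by (simp add: algebra_simps)
    then have "norm ((x - xbar) /\<^sub>R t - u) \<le> norm ((x0 - xbar) /\<^sub>R t - u) + norm ((x0 - x) /\<^sub>R t)"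
      by (metis norm_triangle_ineq4)
    also have "norm ((x0 - x) /\<^sub>R t) = norm (x0 - x) / t"
      using t(1) by (simp add: divide_inverse mult.commute)
    also have "\<dots> \<le> s / 2"
      using x_near t(1) by (simp add: pos_divide_le_eq)
    finally show ?thesis
      using t(3) by simp
  qed
  have x_nbhd: "x \<in> dir_nbhd \<epsilon> \<delta> xbar u" "norm (x - xbar) < r / 2"
    using \<tau>0(2)[of t x] t x_dir s by auto
  then have x_ball: "x \<in> ball xbar r"
    using r by (simp add: dist_norm norm_minus_commute)
  have "m * norm y \<le> m * (s * t)"
  proof -
    have "m * norm y \<le> q"
      unfolding q_def by (rule f.lower)
    also have "q \<le> \<mu> * t"
    proof -
      have "0 \<le> \<sigma> * norm (x0 - x)" using \<sigma>(1) by simp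
      with dist_x f0_small show ?thesis by linarith
    qed
    also have "\<dots> \<le> m * s * t"
      using \<mu>(3) t(1) by (intro mult_right_mono) auto
    finally show ?thesis by simp
  qed
  then have y_small: "norm y \<le> s * t"
    using f.m_pos by simp
  have y_parts: "norm (P1 x - z1) \<le> s * t" "norm (P2 x - z2) \<le> s * t"
    using y_small norm_fst_le[of "P1 x - z1" "P2 x - z2"] norm_snd_le[of "P2 x - z2" "P1 x - z1"]
    unfolding y_def by linarith+
  have half: "q / 2 \<le> sqrt (ip2 (P2 x - z2) (P2 x - z2))"
    unfolding q_def y_def ip_def fst_conv snd_conv
  proof (rule multiplier_second_component_ge[OF form1 form2 z, where ?P1.0 = P1 and ?P2.0 = P2 and \<sigma> = \<sigma> and \<kappa> = \<kappa>])
    show "\<exists>x'. P1 x' \<in> \<Lambda>1 \<and> norm (x' - x) \<le> \<kappa> * norm (P1 x - z1) \<and>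
      norm (P1 x' - P1 x) \<le> L * norm (x' - x) \<and> norm (P2 x' - P2 x) \<le> L * norm (x' - x)" if ne: "P1 x \<noteq> z1"
    proof -
      obtain x' where x': "P1 x' \<in> \<Lambda>1" "norm (x' - x) \<le> \<kappa> * norm (P1 x - z1)"
        using subreg[OF x_nbhd(1) z(1) ne] by blast
      have "s * t \<le> s"
        using s(1,2) t mult_left_mono[of t 1 s] by simp
      then have "\<kappa> * norm (P1 x - z1) \<le> \<kappa> * s"
        using y_parts(1) pos(3) by (intro mult_left_mono) auto
      with x'(2) s(5) have "norm (x' - x) \<le> r / 2"
        by simp
      then have "norm (x' - xbar) < r"
        using x_nbhd(2) norm_triangle_ineq[of "x' - x" "x - xbar"] by simp
      then have "x' \<in> ball xbar r"
        by (simp add: dist_norm norm_minus_commute)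
      with x' lip x_ball show ?thesis by blast
    qed
  qed (use min \<sigma> C2 L m1 in \<open>auto simp: q_def y_def ip_def\<close>)
  define v1 where "v1 = (P1 x - z1) /\<^sub>R q"
  define v2 where "v2 = (P2 x - z2) /\<^sub>R q"
  have v: "y /\<^sub>R sqrt (ip y y) = (v1, v2)"
    by (simp add: v1_def v2_def y_def q_def scaleR_prod_def)
  have sqrt_v1: "sqrt (ip1 v1 v1) = sqrt (ip1 (P1 x - z1) (P1 x - z1)) / q"
    using q by (simp add: v1_def f1.scaleR_left f1.scaleR_right real_sqrt_mult divide_inverse)
  have sqrt_v2: "sqrt (ip2 v2 v2) = sqrt (ip2 (P2 x - z2) (P2 x - z2)) / q"
    using q by (simp add: v2_def f2.scaleR_left f2.scaleR_right real_sqrt_mult divide_inverse)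
  have "sqrt (ip1 (P1 x - z1) (P1 x - z1)) \<le> q" "sqrt (ip2 (P2 x - z2) (P2 x - z2)) \<le> q"
    using f1.self_nonneg f2.self_nonneg by (simp_all add: q_def y_def ip_def)
  with half q have v_bounds: "sqrt (ip1 v1 v1) \<le> 1" "sqrt (ip2 v2 v2) \<le> 1" "1 / 2 \<le> sqrt (ip2 v2 v2)"
    unfolding sqrt_v1 sqrt_v2 by (auto simp: field_simps)
  have stationary: "\<bar>ip1 v1 (D1 x h) + ip2 v2 (D2 x h)\<bar> \<le> \<tau> * norm h" for h
  proof -
    have "\<bar>ip (y /\<^sub>R sqrt (ip y y)) (D1 x h, D2 x h)\<bar> \<le> \<sigma> * norm h"
    proof (rule f.stationary_derivative[where P = "\<lambda>x. (P1 x, P2 x)" and x = x])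
      show "((\<lambda>x. (P1 x, P2 x)) has_derivative (\<lambda>h. (D1 x h, D2 x h))) (at x)"
        by (intro has_derivative_Pair deriv x_ball)
      fix x'
      have "dist (x, z1, z2) (x', z1, z2) = norm (x' - x)"
        by (simp add: dist_Pair_Pair dist_norm norm_minus_commute)
      with min[OF z, of x'] show "sqrt (ip y y) \<le> sqrt (ip (y + ((P1 x', P2 x') - (P1 x, P2 x)))
          (y + ((P1 x', P2 x') - (P1 x, P2 x)))) + \<sigma> * norm (x' - x)"
        by (simp add: q_def y_def)
    qed fact
    also have "\<dots> \<le> \<tau> * norm h"
      using \<sigma> by (intro mult_right_mono) auto
    finally show ?thesis
      unfolding v by (simp add: ip_def)
  qed
  obtain B where B: "B > 0" "\<And>p p'. norm (ip p p') \<le> norm p * norm p' * B"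
    using f.pos_bounded by blast
  \<comment> \<open>This grows without bound as q tends to zero, but q is fixed here and
    epsilon-normality is local at a fixed base point.\<close>
  define C' where "C' = B / (2 * q)"
  have C': "C' \<ge> 0"
    using B q by (simp add: C'_def)
  have normal: "ip (v1, v2) (z1' - z1, z2' - z2) \<le> \<sigma> * norm (z1' - z1, z2' - z2) + C' * (norm (z1' - z1, z2' - z2))\<^sup>2"
    if z': "z1' \<in> \<Lambda>1" "z2' \<in> \<Lambda>2" for z1' z2'
  proof -
    define h where "h = (z1' - z1, z2' - z2)"
    \<comment> \<open>With x frozen, moving the targets changes the residual by exactly
      \<open>- h\<close>.\<close>
    have "dist (x, z1, z2) (x, z1', z2') = norm h"
      by (simp add: dist_Pair_Pair norm_Pair dist_norm norm_minus_commute h_def)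
    then have "sqrt (ip y y) \<le> sqrt (ip (y + - h) (y + - h)) + \<sigma> * norm h"
      using min[OF z', of x] by (simp add: q_def y_def h_def)
    from f.first_order_inequality[OF \<open>y \<noteq> 0\<close> this]
    have "ip (v1, v2) h \<le> \<sigma> * norm h + ip h h / (2 * q)"
      by (simp add: v q_def f.minus_left f.minus_right)
    also have "ip h h / (2 * q) \<le> C' * (norm h)\<^sup>2"
      using B(2)[of h h] q by (simp add: C'_def field_simps power2_eq_square)
    finally show ?thesis
      by (simp add: h_def)
  qed
  have "Blinfun (ip1 v1) \<in> eps_normals \<tau> z1 \<Lambda>1"
  proof (rule eps_normalsI[OF z(1) C' \<sigma>(3)])
    fix w assume "w \<in> \<Lambda>1"
    from normal[OF this z(2)]
    show "blinfun_apply (Blinfun (ip1 v1)) (w - z1) \<le> \<sigma> * norm (w - z1) + C' * (norm (w - z1))\<^sup>2"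
      by (simp add: bounded_linear_Blinfun_apply f1.bounded_linear_right ip_def f2.zero_right norm_Pair)
  qed
  moreover have "Blinfun (ip2 v2) \<in> eps_normals \<tau> z2 \<Lambda>2"
  proof (rule eps_normalsI[OF z(2) C' \<sigma>(3)])
    fix w assume "w \<in> \<Lambda>2"
    from normal[OF z(1) this]
    show "blinfun_apply (Blinfun (ip2 v2)) (w - z2) \<le> \<sigma> * norm (w - z2) + C' * (norm (w - z2))\<^sup>2"
      by (simp add: bounded_linear_Blinfun_apply f2.bounded_linear_right ip_def f1.zero_right norm_Pair)
  qed
  moreover have "norm (P1 x - z1) \<le> \<tau> * t" "norm (P2 x - z2) \<le> \<tau> * t"
  proof -
    have "s * t \<le> \<tau> * t"
      using s(3) t(1) by (intro mult_right_mono) auto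
    with y_parts show "norm (P1 x - z1) \<le> \<tau> * t" "norm (P2 x - z2) \<le> \<tau> * t"
      by linarith+
  qed
  ultimately show ?thesis
    using t s x_dir x_ball z v_bounds stationary
    by (intro exI[of _ t] exI[of _ x] exI[of _ z1] exI[of _ z2] exI[of _ v1] exI[of _ v2] conjI allI) auto
qed

section \<open>Passage to the limit and contradiction\<close>

theorem corollary4p14:
  fixes P1 :: "'x::banach \<Rightarrow> 'y1::real_normed_vector"
    and P2 :: "'x \<Rightarrow> 'y2::real_normed_vector"
    and \<Lambda>1 :: "'y1 set" and \<Lambda>2 :: "'y2 set"
    and F1 :: "'x \<Rightarrow> 'y1 set" and F2 :: "'x \<Rightarrow> 'y2 set"
    and F :: "'x \<Rightarrow> ('y1 \<times> 'y2) set"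
    and xbar u :: 'x
  assumes "asplund_space TYPE('x)"
    and "finite_dim_space TYPE('y1)" and "finite_dim_space TYPE('y2)"
    and "continuous_on UNIV P1" and "continuous_on UNIV P2"
    and "cont_frechet_differentiable_at P1 xbar"
    and "cont_frechet_differentiable_at P2 xbar"
    and "closed \<Lambda>1" and "closed \<Lambda>2"
    and "F1 = constraint_map P1 \<Lambda>1" and "F2 = constraint_map P2 \<Lambda>2"
    and "0 \<in> F1 xbar" and "0 \<in> F2 xbar"
    and "F = (\<lambda>x. F1 x \<times> F2 x)"
    and "blinfun_apply (frechet_grad P1 xbar) u \<in> contingent_cone (P1 xbar) \<Lambda>1"
    and "blinfun_apply (frechet_grad P2 xbar) u \<in> contingent_cone (P2 xbar) \<Lambda>2"
    and "metrically_subregular_dir norm F1 xbar 0 u"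
    and "\<And>(y1s :: 'y1 \<Rightarrow>\<^sub>L real) (y2s :: 'y2 \<Rightarrow>\<^sub>L real).
           dual_adjoint (frechet_grad P1 xbar) y1s + dual_adjoint (frechet_grad P2 xbar) y2s = 0 \<Longrightarrow>
           y1s \<in> dir_limiting_normals (P1 xbar) \<Lambda>1 (blinfun_apply (frechet_grad P1 xbar) u) \<Longrightarrow>
           y2s \<in> dir_limiting_normals (P2 xbar) \<Lambda>2 (blinfun_apply (frechet_grad P2 xbar) u) \<Longrightarrow>
           y2s = 0"
  shows "metrically_subregular_dir sum_norm F xbar (0, 0) u"
proof (rule ccontr)
  note fin = assms(2,3) and cont = assms(4,5) and diff = assms(6,7) and qualification = assms(18)
  note F1 = assms(10) and F2 = assms(11) and F = assms(14)
  assume not_subreg: "\<not> metrically_subregular_dir sum_norm F xbar (0, 0) u"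
  have xbar: "P1 xbar \<in> \<Lambda>1" "P2 xbar \<in> \<Lambda>2"
    using assms(12,13) by (auto simp: F1 F2 constraint_map_def)
  obtain r1 L1 where 1: "r1 > 0" "L1 \<ge> 0"
    "\<And>x. x \<in> ball xbar r1 \<Longrightarrow> (P1 has_derivative blinfun_apply (frechet_grad P1 x)) (at x)"
    "\<And>x x'. x \<in> ball xbar r1 \<Longrightarrow> x' \<in> ball xbar r1 \<Longrightarrow> norm (P1 x - P1 x') \<le> L1 * norm (x - x')"
    using cont_frechet_differentiable_lipschitz[OF diff(1)] by metis
  obtain r2 L2 where 2: "r2 > 0" "L2 \<ge> 0"
    "\<And>x. x \<in> ball xbar r2 \<Longrightarrow> (P2 has_derivative blinfun_apply (frechet_grad P2 x)) (at x)"
    "\<And>x x'. x \<in> ball xbar r2 \<Longrightarrow> x' \<in> ball xbar r2 \<Longrightarrow> norm (P2 x - P2 x') \<le> L2 * norm (x - x')"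
    using cont_frechet_differentiable_lipschitz[OF diff(2)] by metis
  define r where "r = min r1 r2"
  define L where "L = max L1 L2"
  have r: "r > 0" and L: "L \<ge> 0"
    using 1 2 by (auto simp: r_def L_def)
  have deriv: "(P1 has_derivative blinfun_apply (frechet_grad P1 x)) (at x)"
      "(P2 has_derivative blinfun_apply (frechet_grad P2 x)) (at x)" if "x \<in> ball xbar r" for x
    using 1(3)[of x] 2(3)[of x] that by (auto simp: r_def)
  have lip: "norm (P1 x - P1 x') \<le> L * norm (x - x')" "norm (P2 x - P2 x') \<le> L * norm (x - x')"
    if "x \<in> ball xbar r" "x' \<in> ball xbar r" for x x'
  proof -
    have "L1 * norm (x - x') \<le> L * norm (x - x')" "L2 * norm (x - x') \<le> L * norm (x - x')"
      by (auto simp: L_def intro!: mult_right_mono)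
    then show "norm (P1 x - P1 x') \<le> L * norm (x - x')" "norm (P2 x - P2 x') \<le> L * norm (x - x')"
      using 1(4)[of x x'] 2(4)[of x x'] that by (auto simp: r_def)
  qed
  obtain \<epsilon> \<delta> \<kappa> where subreg: "\<epsilon> > 0" "\<delta> > 0" "\<kappa> > 0"
    "\<And>x z. x \<in> dir_nbhd \<epsilon> \<delta> xbar u \<Longrightarrow> z \<in> \<Lambda>1 \<Longrightarrow> P1 x \<noteq> z \<Longrightarrow>
      \<exists>x'. P1 x' \<in> \<Lambda>1 \<and> norm (x' - x) \<le> \<kappa> * norm (P1 x - z)"
    using subregular_solution[OF assms(17)[unfolded F1]] by metis
  \<comment> \<open>This form is fixed first, with lower constant 1, because its upper constant
    \<open>C2\<close> enters \<open>m1\<close>.\<close>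
  obtain ip2 :: "'y2 \<Rightarrow> 'y2 \<Rightarrow> real" where form2: "inner_form ip2 1"
    using finite_dim_inner_form[OF fin(2)] zero_less_one by metis
  interpret f2: inner_form ip2 1 by (rule form2)
  obtain C2 where C2: "C2 > 0" "\<And>y. sqrt (ip2 y y) \<le> C2 * norm y"
    by (rule f2.upper) blast
  \<comment> \<open>A steep form on the first factor makes violations of the first constraint too expensive.\<close>
  define m1 where "m1 = 2 * (C2 * L * \<kappa> + \<kappa> + 1 + L * \<kappa>)"
  have m1: "m1 > 0"
    using C2(1) L subreg(3) unfolding m1_def by (intro mult_pos_pos add_nonneg_pos add_pos_nonneg) auto
  obtain ip1 :: "'y1 \<Rightarrow> 'y1 \<Rightarrow> real" where form1: "inner_form ip1 m1"
    using finite_dim_inner_form[OF fin(1) m1] by metis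
  interpret f1: inner_form ip1 m1 by (rule form1)
  define \<tau> where "\<tau> n = inverse (real (Suc n))" for n
  have \<tau>: "\<tau> n > 0" "\<tau> \<longlonglongrightarrow> 0" for n
    unfolding \<tau>_def[abs_def] using LIMSEQ_inverse_real_of_nat by simp_all
  \<comment> \<open>A single predicate on tuples lets one choice produce all six sequences
    simultaneously.\<close>
  define G where "G n = (\<lambda>(t, x, z1, z2, v1, v2). 0 < t \<and> t < \<tau> n \<and> norm ((x - xbar) /\<^sub>R t - u) \<le> \<tau> n \<and> x \<in> ball xbar r \<and>
    z1 \<in> \<Lambda>1 \<and> z2 \<in> \<Lambda>2 \<and> norm (P1 x - z1) \<le> \<tau> n * t \<and> norm (P2 x - z2) \<le> \<tau> n * t \<and>
    sqrt (ip1 v1 v1) \<le> 1 \<and> sqrt (ip2 v2 v2) \<le> 1 \<and> 1 / 2 \<le> sqrt (ip2 v2 v2) \<and>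
    (\<forall>h. \<bar>ip1 v1 (frechet_grad P1 x h) + ip2 v2 (frechet_grad P2 x h)\<bar> \<le> \<tau> n * norm h) \<and>
    Blinfun (ip1 v1) \<in> eps_normals (\<tau> n) z1 \<Lambda>1 \<and> Blinfun (ip2 v2) \<in> eps_normals (\<tau> n) z2 \<Lambda>2)" for n
  have "\<exists>p. G n p" for n
    unfolding G_def split_paired_Ex prod.case
  proof (rule approximate_multipliers[OF form1 form2 cont _ _ xbar r L deriv lip subreg C2(2)])
    show "complete \<Lambda>1" "complete \<Lambda>2"
      using finite_dim_complete fin assms(8,9) by blast+
    show "\<exists>x\<in>dir_nbhd \<epsilon> \<delta> xbar u. \<exists>z1\<in>\<Lambda>1. \<exists>z2\<in>\<Lambda>2. \<forall>x'. P1 x' \<in> \<Lambda>1 \<longrightarrow> P2 x' \<in> \<Lambda>2 \<longrightarrow>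
        \<kappa> * (norm (P1 x - z1) + norm (P2 x - z2)) < norm (x - x')"
      if "\<epsilon> > 0" "\<delta> > 0" "\<kappa> > 0" for \<epsilon> \<delta> \<kappa>
      using not_subregular_witness[OF not_subreg[unfolded F F1 F2] xbar that] .
  qed (use C2(1) \<tau> in \<open>auto simp: m1_def\<close>)
  then obtain p where p: "\<And>n. G n (p n)"
    by metis
  define t x z1 z2 v1 v2 where "t n = fst (p n)" and "x n = fst (snd (p n))"
    and "z1 n = fst (snd (snd (p n)))" and "z2 n = fst (snd (snd (snd (p n))))"
    and "v1 n = fst (snd (snd (snd (snd (p n)))))" and "v2 n = snd (snd (snd (snd (snd (p n)))))" for n
  have t: "0 < t n" "t n < \<tau> n" and x: "norm ((x n - xbar) /\<^sub>R t n - u) \<le> \<tau> n"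
    and z: "z1 n \<in> \<Lambda>1" "z2 n \<in> \<Lambda>2" "norm (P1 (x n) - z1 n) \<le> \<tau> n * t n" "norm (P2 (x n) - z2 n) \<le> \<tau> n * t n"
    and v: "sqrt (ip1 (v1 n) (v1 n)) \<le> 1" "sqrt (ip2 (v2 n) (v2 n)) \<le> 1" "1 / 2 \<le> sqrt (ip2 (v2 n) (v2 n))"
    and stat: "\<bar>ip1 (v1 n) (frechet_grad P1 (x n) h) + ip2 (v2 n) (frechet_grad P2 (x n) h)\<bar> \<le> \<tau> n * norm h"
    and normal: "Blinfun (ip1 (v1 n)) \<in> eps_normals (\<tau> n) (z1 n) \<Lambda>1" "Blinfun (ip2 (v2 n)) \<in> eps_normals (\<tau> n) (z2 n) \<Lambda>2"
    for n h
    using p[of n] unfolding G_def t_def x_def z1_def z2_def v1_def v2_def case_prod_beta by blast+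
  have "bounded (range v1)"
    unfolding bounded_iff
  proof (intro exI ballI)
    fix w assume "w \<in> range v1"
    then have "m1 * norm w \<le> 1"
      using f1.lower[of w] v(1) order_trans by blast
    then show "norm w \<le> 1 / m1"
      using m1 by (simp add: pos_le_divide_eq mult.commute)
  qed
  then obtain w1 r1 where r1: "strict_mono (r1 :: nat \<Rightarrow> nat)" and w1: "(v1 \<circ> r1) \<longlonglongrightarrow> w1"
    using finite_dim_convergent_subseq[OF fin(1)] by metis
  have "norm (v2 n) \<le> 1" for n
    using f2.lower[of "v2 n"] v(2)[of n] by linarith
  then have "bounded (range (v2 \<circ> r1))"
    by (auto simp: bounded_iff)
  then obtain w2 r2 where r2: "strict_mono (r2 :: nat \<Rightarrow> nat)" and w2: "(v2 \<circ> r1 \<circ> r2) \<longlonglongrightarrow> w2"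
    using finite_dim_convergent_subseq[OF fin(2)] by metis
  define k where "k = r1 \<circ> r2"
  have k: "strict_mono k"
    using r1 r2 by (simp add: k_def strict_mono_o)
  have v1_lim: "(\<lambda>n. v1 (k n)) \<longlonglongrightarrow> w1" and v2_lim: "(\<lambda>n. v2 (k n)) \<longlonglongrightarrow> w2"
    using LIMSEQ_subseq_LIMSEQ[OF w1 r2] w2 by (simp_all add: k_def comp_def)
  have \<tau>_lim: "(\<lambda>n. \<tau> (k n)) \<longlonglongrightarrow> 0"
    using LIMSEQ_subseq_LIMSEQ[OF \<tau>(2) k] by (simp add: comp_def)
  have t_lim: "(\<lambda>n. t (k n)) \<longlonglongrightarrow> 0"
    by (rule tendsto_sandwich[OF _ _ tendsto_const \<tau>_lim]) (use t in \<open>auto intro!: always_eventually less_imp_le\<close>)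
  have x_lim: "(\<lambda>n. (x (k n) - xbar) /\<^sub>R t (k n)) \<longlonglongrightarrow> u"
    by (rule LIM_zero_cancel, rule Lim_null_comparison[OF always_eventually \<tau>_lim]) (use x in blast)
  have "(\<lambda>n. xbar + t (k n) *\<^sub>R ((x (k n) - xbar) /\<^sub>R t (k n))) \<longlonglongrightarrow> xbar + 0 *\<^sub>R u"
    by (intro tendsto_intros t_lim x_lim)
  moreover have "xbar + t n *\<^sub>R ((x n - xbar) /\<^sub>R t n) = x n" for n
    using t(1)[of n] by simp
  ultimately have x_lim': "(\<lambda>n. x (k n)) \<longlonglongrightarrow> xbar"
    by simp
  have xbar_ball: "xbar \<in> ball xbar r"
    using r by simp
  have normals: "Blinfun (ip1 w1) \<in> dir_limiting_normals (P1 xbar) \<Lambda>1 (frechet_grad P1 xbar u)"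
      "Blinfun (ip2 w2) \<in> dir_limiting_normals (P2 xbar) \<Lambda>2 (frechet_grad P2 xbar u)"
    by (rule dir_limiting_normalsI[OF form1 t(1) t_lim \<tau>(1) \<tau>_lim
          directional_image[OF deriv(1)[OF xbar_ball] t(1) t_lim \<tau>_lim x_lim z(3)] z(1) v1_lim normal(1)]
        dir_limiting_normalsI[OF form2 t(1) t_lim \<tau>(1) \<tau>_lim
          directional_image[OF deriv(2)[OF xbar_ball] t(1) t_lim \<tau>_lim x_lim z(4)] z(2) v2_lim normal(2)])+
  \<comment> \<open>Continuity of the gradients at \<open>xbar\<close> enters here: the approximate
    equations live at \<open>x (k n)\<close>, the limit equation at \<open>xbar\<close>.\<close>
  have grad: "(\<lambda>n. frechet_grad P1 (x (k n)) h) \<longlonglongrightarrow> frechet_grad P1 xbar h"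
      "(\<lambda>n. frechet_grad P2 (x (k n)) h) \<longlonglongrightarrow> frechet_grad P2 xbar h" for h
    using diff unfolding cont_frechet_differentiable_at_def
    by (auto intro: blinfun.tendsto[OF isCont_tendsto_compose[OF _ x_lim'] tendsto_const])
  have adjoint: "ip1 w1 (frechet_grad P1 xbar h) + ip2 w2 (frechet_grad P2 xbar h) = 0" for h
  proof (rule LIMSEQ_unique)
    show "(\<lambda>n. ip1 (v1 (k n)) (frechet_grad P1 (x (k n)) h) + ip2 (v2 (k n)) (frechet_grad P2 (x (k n)) h))
      \<longlonglongrightarrow> ip1 w1 (frechet_grad P1 xbar h) + ip2 w2 (frechet_grad P2 xbar h)"
      by (intro tendsto_add f1.tendsto f2.tendsto v1_lim v2_lim grad)
    have "(\<lambda>n. \<tau> (k n) * norm h) \<longlonglongrightarrow> 0"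
      using tendsto_mult_right[OF \<tau>_lim, of "norm h"] by simp
    then show "(\<lambda>n. ip1 (v1 (k n)) (frechet_grad P1 (x (k n)) h) + ip2 (v2 (k n)) (frechet_grad P2 (x (k n)) h))
      \<longlonglongrightarrow> 0"
      by (rule Lim_null_comparison[rotated]) (use stat in \<open>auto intro: always_eventually\<close>)
  qed
  have "Blinfun (ip2 w2) = 0"
  proof (rule qualification[OF _ normals])
    show "dual_adjoint (frechet_grad P1 xbar) (Blinfun (ip1 w1)) +
        dual_adjoint (frechet_grad P2 xbar) (Blinfun (ip2 w2)) = 0"
      by (rule blinfun_eqI)
        (simp add: dual_adjoint_def blinfun.add_left bounded_linear_Blinfun_apply
          f1.bounded_linear_right f2.bounded_linear_right adjoint)
  qed
  \<comment> \<open>The functional is tested on its own representing vector; the lower bound 1/2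
    survives the limit because the vectors converge in norm.\<close>
  then have "blinfun_apply (Blinfun (ip2 w2)) w2 = 0"
    by simp
  then have "ip2 w2 w2 = 0"
    by (simp add: bounded_linear_Blinfun_apply f2.bounded_linear_right)
  moreover have "1 / 2 \<le> sqrt (ip2 w2 w2)"
    by (rule LIMSEQ_le_const[OF tendsto_real_sqrt[OF f2.tendsto[OF v2_lim v2_lim]]]) (use v(3) in blast)
  ultimately show False
    by simp
qed

end
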